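(* Let $G$ be a flow-critical graph. If $G$ has at most one vertex of degree at least $7$, then $|E(G)|\le 3|V(G)|-5$.
   Context: Graphs are finite, loopless, and may have parallel edges. A nowhere-zero $3$-flow of a graph $G$ is an orientation of $G$ such that $\deg^+(v)-\deg^-(v)\equiv 0\pmod 3$ for every vertex $v$. For a partition $\mathcal P$ of $V(G)$, $G/\mathcal P$ denotes the graph obtained by identifying the vertices of each part into a single vertex and deleting all loops; $\mathcal P$ is non-trivial if some part has at least two vertices. A graph $G$ is flow-critical if $G$ has no nowhere-zero $3$-flow, but $G/\mathcal P$ has a nowhere-zero $3$-flow for every non-trivial partition $\mathcal P$ of $V(G)$ (parts need not induce connected subgraphs). *)

theory Defs
  imports "Graph_Theory.Digraph" "HOL-Library.Disjoint_Sets" "HOL-Number_Theory.Cong"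
begin

text \<open>Edges have their own identity, so distinct edges may have the same pair of ends.\<close>

record ('v, 'e) multigraph =
  mverts :: "'v set"
  medges :: "'e set"
  mends :: "'e \<Rightarrow> 'v set"

locale loopless_multigraph =
  fixes G :: "('v, 'e) multigraph"
  assumes finite_mverts: "finite (mverts G)"
    and finite_medges: "finite (medges G)"
    and mends_subset: "e \<in> medges G \<Longrightarrow> mends G e \<subseteq> mverts G"
    and card_mends: "e \<in> medges G \<Longrightarrow> card (mends G e) = 2"

definition mdegree :: "('v, 'e) multigraph \<Rightarrow> 'v \<Rightarrow> nat" where
  "mdegree G v = card {e \<in> medges G. v \<in> mends G e}"

definition orientation :: "('v, 'e) multigraph \<Rightarrow> ('v, 'e) pre_digraph \<Rightarrow> bool" where
  "orientation G D \<longleftrightarrow> verts D = mverts G \<and> arcs D = medges G \<and>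
     (\<forall>e \<in> medges G. mends G e = {tail D e, head D e})"

definition nowhere_zero_3_flow :: "('v, 'e) multigraph \<Rightarrow> ('v, 'e) pre_digraph \<Rightarrow> bool" where
  "nowhere_zero_3_flow G D \<longleftrightarrow> orientation G D \<and>
     (\<forall>v \<in> mverts G. [int (out_degree D v) - int (in_degree D v) = 0] (mod 3))"

text \<open>
  The vertices of the quotient are the parts. An edge becomes a loop, and is
  deleted, exactly when both its ends lie in the same part.
\<close>

definition quotient_graph :: "('v, 'e) multigraph \<Rightarrow> 'v set set \<Rightarrow> ('v set, 'e) multigraph" where
  "quotient_graph G P =
     \<lparr> mverts = P,
       medges = {e \<in> medges G. \<not> (\<exists>p \<in> P. mends G e \<subseteq> p)},
       mends = (\<lambda>e. {p \<in> P. p \<inter> mends G e \<noteq> {}}) \<rparr>"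

definition nontrivial_partition :: "'v set set \<Rightarrow> bool" where
  "nontrivial_partition P \<longleftrightarrow> (\<exists>p \<in> P. 2 \<le> card p)"

definition flow_critical :: "('v, 'e) multigraph \<Rightarrow> bool" where
  "flow_critical G \<longleftrightarrow>
     (\<nexists>D. nowhere_zero_3_flow G D) \<and>
     (\<forall>P. partition_on (mverts G) P \<and> nontrivial_partition P \<longrightarrow>
        (\<exists>D. nowhere_zero_3_flow (quotient_graph G P) D))"

lemma loopless_multigraph_quotient_graph:
  assumes "loopless_multigraph G" and P: "partition_on (mverts G) P"
  shows "loopless_multigraph (quotient_graph G P)"
proof -
  interpret loopless_multigraph G by fact
  have "card {p \<in> P. p \<inter> mends G e \<noteq> {}} = 2"
    if e: "e \<in> medges G" and nl: "\<not> (\<exists>p \<in> P. mends G e \<subseteq> p)" for e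
  proof -
    obtain u v where uv: "mends G e = {u, v}" "u \<noteq> v"
      using card_mends[OF e] by (auto simp: card_2_iff)
    have "u \<in> \<Union>P" "v \<in> \<Union>P"
      using mends_subset[OF e] P uv by (auto simp: partition_on_def)
    then obtain p q where pq: "p \<in> P" "u \<in> p" "q \<in> P" "v \<in> q" by blast
    have uniq: "r = s" if "r \<in> P" "s \<in> P" "x \<in> r" "x \<in> s" for r s x
      using P that by (auto simp: partition_on_def disjoint_def)
    have "{r \<in> P. r \<inter> mends G e \<noteq> {}} = {p, q}"
    proof (intro equalityI subsetI)
      fix r assume "r \<in> {r \<in> P. r \<inter> mends G e \<noteq> {}}"
      then have r: "r \<in> P" "u \<in> r \<or> v \<in> r" using uv by auto
      then show "r \<in> {p, q}"
        using uniq[OF r(1) pq(1), of u] uniq[OF r(1) pq(3), of v] pq by auto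
    next
      fix r assume "r \<in> {p, q}"
      then show "r \<in> {r \<in> P. r \<inter> mends G e \<noteq> {}}" using pq uv by auto
    qed
    moreover have "p \<noteq> q" using nl uv pq by auto
    ultimately show ?thesis by simp
  qed
  then show ?thesis
    using finite_mverts finite_medges finite_elements[OF finite_mverts P]
    by unfold_locales (simp_all add: quotient_graph_def)
qed

end

theory Submission
  imports Defs "HOL-Library.Multiset"
begin

text \<open>
  Fix a root \<open>z\<close> and call a vertex set \<open>X\<close> together with a boundary \<open>b\<close> critical if the graph obtained by
  merging everything outside \<open>X\<close> into \<open>z\<close> has no orientation with boundary \<open>b\<close> modulo 3 on \<open>X\<close>, but
  merging any further vertices into \<open>z\<close> creates one. The class of instances in which every
  non-root vertex has degree at most 5, or degree 6 and boundary 0, is closed under deleting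
  oriented edges, splitting off pairs of edges and merging into \<open>z\<close>. If moreover every nonempty set
  \<open>S\<close> of non-root vertices spans at most \<open>3|S| - 3\<close> edges, then a critical instance has at most
  \<open>3|X| - 2\<close> edges.

  In a least counterexample, proper sets containing \<open>z\<close> are sparse by induction and parallel edges
  at \<open>z\<close> are impossible. A vertex of degree 4, 5 or 6 that is not of degree 5 with boundary 0 can be
  removed at a cost of exactly three edges: split off (degree - 3) pairs and orient the rest. Hence all
  non-root vertices have degree 5 and boundary 0, and all but at most two of them are neighbours of \<open>z\<close>. If two
  neighbours \<open>y\<close>, \<open>w\<close> of \<open>z\<close> are adjacent, split off the path \<open>z y w\<close> and let the other three edges
  leave \<open>y\<close>; now \<open>z\<close> and \<open>w\<close> are joined by two edges, so \<open>w\<close> can be merged into \<open>z\<close>. This removes six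
  edges and two vertices. So the neighbours of \<open>z\<close> are independent, counting leaves only the case in
  which \<open>z\<close> has degree 2, and there \<open>z\<close> can be deleted and another root chosen.

  For the theorem, \<open>z\<close> is the vertex of large degree. The bound \<open>3|S| - 3\<close> follows by applying the
  same result inside a smallest set violating it, rooted at one of its own vertices.
\<close>

section \<open>Orientations with prescribed boundary modulo 3\<close>

definition ends :: "'v \<times> 'v \<Rightarrow> 'v set" where
  "ends a = {fst a, snd a}"

definition net :: "('v \<times> 'v) multiset \<Rightarrow> 'v \<Rightarrow> int" where
  "net A v = int (count (image_mset fst A) v) - int (count (image_mset snd A) v)"

text \<open>
  Ends of edges outside \<open>X\<close> all play the role of the root, where nothing is required.
  Merging \<open>X - Y\<close> into the root therefore just replaces \<open>X\<close> by \<open>Y\<close> and \<open>U\<close> by \<open>touching U Y\<close>.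
\<close>
definition orientable :: "'v set \<Rightarrow> 'v set multiset \<Rightarrow> ('v \<Rightarrow> int) \<Rightarrow> bool" where
  "orientable X U b \<longleftrightarrow> (\<exists>A. image_mset ends A = U \<and> (\<forall>v \<in> X. 3 dvd net A v - b v))"

definition inside :: "'v set multiset \<Rightarrow> 'v set \<Rightarrow> nat" where
  "inside U S = size (filter_mset (\<lambda>e. e \<subseteq> S) U)"

definition touching :: "'v set multiset \<Rightarrow> 'v set \<Rightarrow> 'v set multiset" where
  "touching U S = filter_mset (\<lambda>e. e \<inter> S \<noteq> {}) U"

text \<open>With \<open>S = X - W\<close> these are the edges spanned by \<open>W\<close> together
  with the root, the ones lost when \<open>W\<close> is merged into it.\<close>

definition avoiding :: "'v set multiset \<Rightarrow> 'v set \<Rightarrow> 'v set multiset" where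
  "avoiding U S = filter_mset (\<lambda>e. e \<inter> S = {}) U"

definition degr :: "'v set multiset \<Rightarrow> 'v \<Rightarrow> nat" where
  "degr U v = size (filter_mset (\<lambda>e. v \<in> e) U)"

definition star :: "'v \<Rightarrow> 'v multiset \<Rightarrow> 'v multiset \<Rightarrow> ('v \<times> 'v) multiset" where
  "star v P Q = image_mset (\<lambda>x. (v, x)) P + image_mset (\<lambda>x. (x, v)) Q"

section \<open>Counting identities for edge and arc multisets\<close>

lemma touching_plus_avoiding: "touching U S + avoiding U S = U"
  unfolding touching_def avoiding_def using multiset_partition[of U "\<lambda>e. e \<inter> S \<noteq> {}"] by simp

lemma touching_touching: "T \<subseteq> S \<Longrightarrow> touching (touching U S) T = touching U T"
  unfolding touching_def filter_filter_mset by (rule filter_mset_cong) auto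

lemma touching_self: "\<forall>e \<in># U. e \<inter> X \<noteq> {} \<Longrightarrow> touching U X = U"
  unfolding touching_def by (simp add: filter_mset_eq_conv)

lemma inside_union [simp]: "inside (U + W) S = inside U S + inside W S"
  by (simp add: inside_def)

lemma degr_union [simp]: "degr (U + W) v = degr U v + degr W v"
  by (simp add: degr_def)

lemma touching_union [simp]: "touching (U + W) S = touching U S + touching W S"
  by (simp add: touching_def)

lemma avoiding_union [simp]: "avoiding (U + W) S = avoiding U S + avoiding W S"
  by (simp add: avoiding_def)

lemma net_union [simp]: "net (A + B) v = net A v + net B v"
  by (simp add: net_def)

lemma size_filter_mset_mono: "(\<And>e. e \<in># U \<Longrightarrow> P e \<Longrightarrow> Q e) \<Longrightarrow> size (filter_mset P U) \<le> size (filter_mset Q U)"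
  by (induction U) (simp_all add: le_SucI)

lemma image_ends_star: "image_mset ends (star v P Q) = image_mset (\<lambda>x. {v, x}) (P + Q)"
  by (auto simp: star_def ends_def multiset.map_comp comp_def insert_commute)

lemma count_image_pair:
  "count (image_mset (\<lambda>x. c) P) v = (if c = v then size P else 0)"
  by (induction P) auto

lemma net_star_centre:
  assumes "v \<notin># P" "v \<notin># Q"
  shows "net (star v P Q) v = int (size P) - int (size Q)"
proof -
  have "image_mset (\<lambda>x. x) P = P" "image_mset (\<lambda>x. x) Q = Q" by simp_all
  then show ?thesis using assms
    by (simp add: net_def star_def multiset.map_comp comp_def count_image_pair not_in_iff)
qed

lemma net_star_other:
  assumes "x \<noteq> v"
  shows "net (star v P Q) x = int (count Q x) - int (count P x)"
  using assms by (simp add: net_def star_def multiset.map_comp comp_def count_image_pair)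

lemma sum_count: "finite S \<Longrightarrow> (\<Sum>v \<in> S. count M v) = size (filter_mset (\<lambda>v. v \<in> S) M)"
proof (induction M)
  case (add x M)
  have "(\<Sum>v \<in> S. count (add_mset x M) v) = (\<Sum>v \<in> S. count M v + (if v = x then 1 else 0))"
    by (intro sum.cong) auto
  then show ?case using add by (simp add: sum.distrib)
qed simp

lemma sum_net:
  assumes "finite S" "\<forall>a \<in># A. fst a \<in> S \<longleftrightarrow> snd a \<in> S"
  shows "(\<Sum>v \<in> S. net A v) = 0"
proof -
  have "filter_mset (\<lambda>a. fst a \<in> S) A = filter_mset (\<lambda>a. snd a \<in> S) A"
    using assms(2) by (intro filter_mset_cong) auto
  then show ?thesis
    unfolding net_def sum_subtractf of_nat_sum[symmetric] sum_count[OF assms(1)]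
    by (simp add: filter_mset_image_mset)
qed

section \<open>Extending and lifting orientations\<close>

lemma orientable_union:
  assumes "image_mset ends A = U" "orientable X W (\<lambda>v. b v - net A v)"
  shows "orientable X (U + W) b"
proof -
  obtain B where B: "image_mset ends B = W" "\<forall>v \<in> X. 3 dvd net B v - (b v - net A v)"
    using assms(2) by (auto simp: orientable_def)
  show ?thesis unfolding orientable_def
    by (rule exI[of _ "A + B"]) (use assms(1) B in \<open>auto simp: algebra_simps\<close>)
qed

lemma orientable_empty: "\<forall>e \<in># U. card e = 2 \<Longrightarrow> orientable {} U b"
proof -
  assume "\<forall>e \<in># U. card e = 2"
  then have "\<exists>A. image_mset ends A = U"
  proof (induction U)
    case (add e U)
    then obtain A x y where "image_mset ends A = U" "e = {x, y}" by (auto simp: card_2_iff)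
    then have "image_mset ends (add_mset (x, y) A) = add_mset e U" by (simp add: ends_def)
    then show ?case by blast
  qed auto
  then show ?thesis by (auto simp: orientable_def)
qed

text \<open>Two edges at a vertex contribute 2, 0 or -2 to its net, which covers all residues modulo
  3; further edges are peeled off one by one. A single edge realizes exactly the nonzero
  residues.\<close>

lemma split_with_residue:
  fixes N :: "'v multiset" and c :: int
  assumes "2 \<le> size N \<or> size N = 1 \<and> \<not> 3 dvd c \<or> N = {#} \<and> 3 dvd c"
  obtains P Q where "N = P + Q" "3 dvd c - (int (size P) - int (size Q))"
proof -
  have base: "\<exists>P Q. N = P + Q \<and> 3 dvd c - (int (size P) - int (size Q))"
    if "size N = 1 \<and> \<not> 3 dvd c \<or> N = {#} \<and> 3 dvd c \<or> size N = 2" for N :: "'v multiset" and c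
    using that
  proof (elim disjE conjE)
    assume s: "size N = 1" "\<not> 3 dvd c"
    have "3 dvd c - 1 \<or> 3 dvd c + 1" using s(2) by presburger
    then show ?thesis
    proof
      assume "3 dvd c - 1"
      then show ?thesis using s(1) by (intro exI[of _ N] exI[of _ "{#}"]) simp
    next
      assume "3 dvd c + 1"
      then show ?thesis using s(1) by (intro exI[of _ "{#}"] exI[of _ N]) simp
    qed
  next
    assume "N = {#}" "3 dvd c"
    then show ?thesis by simp
  next
    assume s: "size N = 2"
    then obtain x M where M: "N = add_mset x M" "size M = 1" by (cases N) auto
    then obtain y where N: "N = {#x, y#}" using size_1_singleton_mset[OF M(2)] by blast
    have "3 dvd c - 2 \<or> 3 dvd c + 2 \<or> 3 dvd c" by presburger
    then show ?thesis
    proof (elim disjE)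
      assume "3 dvd c - 2" then show ?thesis using s by (intro exI[of _ N] exI[of _ "{#}"]) simp
    next
      assume "3 dvd c + 2" then show ?thesis using s by (intro exI[of _ "{#}"] exI[of _ N]) simp
    next
      assume "3 dvd c" then show ?thesis using N by (intro exI[of _ "{#x#}"] exI[of _ "{#y#}"]) simp
    qed
  qed
  have "\<exists>P Q. N = P + Q \<and> 3 dvd c - (int (size P) - int (size Q))"
  proof (cases "2 \<le> size N")
    case True
    then show ?thesis
    proof (induction "size N" arbitrary: N c rule: less_induct)
      case less
      show ?case
      proof (cases "size N = 2")
        case True then show ?thesis using base by blast
      next
        case False
        with less.prems have g: "size N \<ge> 3" by simp
        then obtain x M where N: "N = add_mset x M"
          by (cases N) auto
        then have "size M < size N" "2 \<le> size M" using g by auto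
        from less.hyps[OF this, of "c - 1"] obtain P Q where
          "M = P + Q" "3 dvd c - 1 - (int (size P) - int (size Q))" by blast
        then show ?thesis using N
          by (intro exI[of _ "add_mset x P"] exI[of _ Q]) (simp add: algebra_simps)
      qed
    qed
  next
    case False
    then show ?thesis using assms base by blast
  qed
  then show ?thesis using that by blast
qed

lemma obtain_neighbours:
  assumes "\<forall>e \<in># U. card e = 2"
  obtains N where "filter_mset (\<lambda>e. v \<in> e) U = image_mset (\<lambda>x. {v, x}) N" "v \<notin># N"
proof -
  have "\<exists>N. filter_mset (\<lambda>e. v \<in> e) U = image_mset (\<lambda>x. {v, x}) N \<and> v \<notin># N"
    using assms
  proof (induction U)
    case (add e U)
    then obtain N where N: "filter_mset (\<lambda>e. v \<in> e) U = image_mset (\<lambda>x. {v, x}) N" "v \<notin># N" by auto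
    show ?case
    proof (cases "v \<in> e")
      case True
      then obtain x where "e = {v, x}" "x \<noteq> v" using add.prems by (auto simp: card_2_iff)
      then show ?thesis using N by (intro exI[of _ "add_mset x N"]) simp
    qed (use N in auto)
  qed auto
  then show ?thesis using that by blast
qed

lemma ends_count:
  assumes "\<forall>a \<in># A. fst a \<noteq> snd a"
  shows "image_mset fst A + image_mset snd A = (\<Sum>e \<in># image_mset ends A. mset_set e)"
  using assms by (induction A) (auto simp: ends_def)

text \<open>This undoes splitting off: each arc replacing a pair of edges at \<open>v\<close> is
  rerouted through \<open>v\<close>, which changes no net value elsewhere and gives \<open>v\<close>
  net 0. The other edges at \<open>v\<close> go out to \<open>P\<close> and come in from
  \<open>Q\<close>; the corrected boundary compensates for them.\<close>

lemma orientable_lift: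
  assumes U: "U = M + image_mset (\<lambda>x. {v, x}) (image_mset fst L + image_mset snd L + P + Q)"
    and v: "\<forall>e \<in># M. v \<notin> e" "v \<notin># image_mset fst L + image_mset snd L + P + Q"
    and L: "\<forall>p \<in># L. fst p \<noteq> snd p"
    and bv: "3 dvd b v - (int (size P) - int (size Q))"
    and ori: "orientable (X - {v}) (M + image_mset ends L)
      (\<lambda>x. b x + int (count P x) - int (count Q x))"
  shows "orientable X U b"
proof -
  obtain A where A: "image_mset ends A = M + image_mset ends L"
    "\<forall>x \<in> X - {v}. 3 dvd net A x - (b x + int (count P x) - int (count Q x))"
    using ori by (auto simp: orientable_def)
  obtain A0 A1 where A01: "A = A0 + A1" "image_mset ends A0 = M" "image_mset ends A1 = image_mset ends L"
    using image_mset_eq_plusD[OF A(1)] by metis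
  have "\<forall>e \<in># image_mset ends L. card e = 2" using L by (auto simp: ends_def card_2_iff)
  then have ne: "\<forall>a \<in># A1. fst a \<noteq> snd a"
    unfolding A01(3)[symmetric] by (auto simp: ends_def)
  \<comment> \<open>The given orientation may reverse entries of \<open>L\<close>, so
    \<open>A1\<close> and \<open>L\<close> agree only in their combined ends.\<close>
  have same: "image_mset fst A1 + image_mset snd A1 = image_mset fst L + image_mset snd L"
    using ends_count[OF ne] ends_count[OF L] A01(3) by simp
  have v1: "v \<notin># image_mset fst A1" "v \<notin># image_mset snd A1"
    using v(2) same by (metis union_iff)+
  have v0: "net A0 v = 0"
  proof -
    have "v \<notin> ends a" if "a \<in># A0" for a using v(1) A01(2) that by auto
    then have "v \<notin># image_mset fst A0" "v \<notin># image_mset snd A0" by (auto simp: ends_def)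
    then show ?thesis unfolding not_in_iff by (simp add: net_def)
  qed
  let ?T = "star v (image_mset snd A1) (image_mset fst A1)"
  have nT: "net ?T v = 0" using v1 by (simp add: net_star_centre)
  have nTx: "net ?T x = net A1 x" if "x \<noteq> v" for x
    unfolding net_star_other[OF that] by (simp add: net_def)
  have vP: "v \<notin># P" "v \<notin># Q" using v(2) by auto
  have "image_mset ends (A0 + ?T + star v P Q) = U"
    unfolding image_mset_union image_ends_star A01(2) U same[symmetric] by (simp add: ac_simps)
  moreover have "3 dvd net (A0 + ?T + star v P Q) x - b x" if "x \<in> X" for x
  proof (cases "x = v")
    case True
    then show ?thesis using v0 nT vP bv
      by (simp add: net_star_centre) (metis dvd_minus_iff minus_diff_eq)
  next
    case False
    then have "3 dvd net A x - (b x + int (count P x) - int (count Q x))" using A(2) that by blast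
    then show ?thesis using False nTx A01(1) by (simp add: net_star_other algebra_simps)
  qed
  ultimately show ?thesis unfolding orientable_def by blast
qed

text \<open>Two edges from \<open>w\<close> to the root repair any residue at \<open>w\<close>
  without affecting the rest of \<open>X\<close>, so \<open>w\<close> can be oriented last.\<close>

lemma orientable_two_root_edges:
  assumes card: "\<forall>e \<in># U. card e = 2 \<and> e \<inter> X \<noteq> {}" and w: "w \<in> X"
    and two: "2 \<le> size (filter_mset (\<lambda>e. e \<inter> X = {w}) U)"
    and ori: "orientable (X - {w}) (touching U (X - {w})) b"
  shows "orientable X U b"
proof -
  let ?F = "filter_mset (\<lambda>e. e \<inter> X = {w}) U"
  have F: "?F = avoiding U (X - {w})"
    unfolding avoiding_def by (rule filter_mset_cong) (use card w in auto)
  obtain N where N: "filter_mset (\<lambda>e. w \<in> e) ?F = image_mset (\<lambda>x. {w, x}) N" "w \<notin># N"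
    using obtain_neighbours[of ?F w] card by auto
  have F': "?F = image_mset (\<lambda>x. {w, x}) N"
    unfolding N(1)[symmetric] filter_filter_mset by (rule filter_mset_cong) auto
  have NX: "x \<notin> X" if "x \<in># N" for x
  proof -
    have "{w, x} \<in># ?F" unfolding F' using that by simp
    then show ?thesis using N(2) that by auto
  qed
  obtain A where A: "image_mset ends A = touching U (X - {w})"
    "\<forall>v \<in> X - {w}. 3 dvd net A v - b v"
    using ori by (auto simp: orientable_def)
  have "2 \<le> size N" using two unfolding F' by simp
  then obtain P Q where PQ: "N = P + Q" "3 dvd (b w - net A w) - (int (size P) - int (size Q))"
    using split_with_residue[of N "b w - net A w"] by blast
  have wPQ: "w \<notin># P" "w \<notin># Q" using N(2) PQ(1) by auto
  have "image_mset ends (A + star w P Q) = U"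
    unfolding image_mset_union image_ends_star A(1) PQ(1)[symmetric] F'[symmetric] F
    by (rule touching_plus_avoiding)
  moreover have "3 dvd net (A + star w P Q) v - b v" if "v \<in> X" for v
  proof (cases "v = w")
    case True
    have "3 dvd - ((b w - net A w) - (int (size P) - int (size Q)))" using PQ(2) by (simp only: dvd_minus_iff)
    then show ?thesis using True wPQ by (simp add: net_star_centre algebra_simps)
  next
    case False
    have "v \<notin># P" "v \<notin># Q" using NX that PQ(1) by auto
    then show ?thesis using False A(2) that by (simp add: net_star_other not_in_iff)
  qed
  ultimately show ?thesis unfolding orientable_def by blast
qed

text \<open>Net values over \<open>S\<close> sum to 0 when all edges lie inside \<open>S\<close>, so
  the requirement at \<open>r\<close> follows from the others. Any vertex of \<open>S\<close> can
  thus serve as root.\<close>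

lemma orientable_drop_root:
  assumes "finite S" "\<forall>e \<in># U. e \<subseteq> S" "3 dvd (\<Sum>x \<in> S. b x)" "r \<in> S"
    and "orientable (S - {r}) U b"
  shows "orientable S U b"
proof -
  obtain A where A: "image_mset ends A = U" "\<forall>v \<in> S - {r}. 3 dvd net A v - b v"
    using assms(5) by (auto simp: orientable_def)
  have "\<forall>a \<in># A. fst a \<in> S \<longleftrightarrow> snd a \<in> S"
    using assms(2) unfolding A(1)[symmetric] by (auto simp: ends_def)
  then have "(\<Sum>x \<in> S. net A x) = 0" by (rule sum_net[OF assms(1)])
  then have "3 dvd (\<Sum>x \<in> S. net A x - b x)" using assms(3) by (simp add: sum_subtractf)
  moreover have "3 dvd (\<Sum>x \<in> S - {r}. net A x - b x)" using A(2) by (intro dvd_sum) auto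
  ultimately have "3 dvd net A r - b r"
    unfolding sum.remove[OF assms(1,4)] by (simp add: dvd_add_left_iff)
  then show ?thesis using A unfolding orientable_def by blast
qed

section \<open>Splitting off pairs of edges while keeping the graph sparse\<close>

definition hits :: "'v multiset \<Rightarrow> 'v set \<Rightarrow> nat" where
  "hits N R = size (filter_mset (\<lambda>x. x \<in> R) N)"

lemma inside_supermodular:
  "inside M R + inside M S \<le> inside M (R \<union> S) + inside M (R \<inter> S)"
  unfolding inside_def by (induction M) auto

lemma hits_modular: "hits N R + hits N S = hits N (R \<union> S) + hits N (R \<inter> S)"
  unfolding hits_def by (induction N) auto

lemma hits_add [simp]: "hits (add_mset x N) R = (if x \<in> R then 1 else 0) + hits N R"
  by (simp add: hits_def)

lemma hits_le_size: "hits N R \<le> size N"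
  by (simp add: hits_def)

lemma hits_mono: "R \<subseteq> S \<Longrightarrow> hits N R \<le> hits N S"
  unfolding hits_def by (rule size_filter_mset_mono) auto

lemma splittable_pair:
  assumes Y: "finite Y"
    and sparse: "\<And>R. R \<subseteq> Y \<Longrightarrow> R \<noteq> {} \<Longrightarrow> inside M R + 3 \<le> 3 * card R"
    and sparse_hits: "\<And>R. R \<subseteq> Y \<Longrightarrow> R \<noteq> {} \<Longrightarrow> inside M R + 3 + hits N R \<le> 3 * card R + k"
    and size: "k < size N" "size N \<le> 2 * k"
  obtains a b N' where "N = add_mset a (add_mset b N')"
    "\<And>R. R \<subseteq> Y \<Longrightarrow> a \<in> R \<Longrightarrow> b \<in> R \<Longrightarrow> inside M R + 4 \<le> 3 * card R"
    "\<And>R. R \<subseteq> Y \<Longrightarrow> R \<noteq> {} \<Longrightarrow> a \<notin> R \<Longrightarrow> b \<notin> R \<Longrightarrow> inside M R + 4 + hits N R \<le> 3 * card R + k"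
proof -
  note choose = that
  \<comment> \<open>A pair is good iff no tight set contains both of its members and every full set contains one of them.
    By submodularity intersecting tight sets have tight unions, intersecting full sets have full
    intersections, and there are at most two disjoint full sets.\<close>
  define tight where "tight R \<longleftrightarrow> R \<subseteq> Y \<and> R \<noteq> {} \<and> inside M R + 3 = 3 * card R" for R
  define full where "full R \<longleftrightarrow> R \<subseteq> Y \<and> R \<noteq> {} \<and> inside M R + 3 + hits N R = 3 * card R + k" for R
  have card_mod: "card R + card S = card (R \<union> S) + card (R \<inter> S)" if "R \<subseteq> Y" "S \<subseteq> Y" for R S
    using that Y by (intro card_Un_Int) (auto intro: finite_subset)
  have tight_Un: "tight (R \<union> S)" if "tight R" "tight S" "R \<inter> S \<noteq> {}" for R S
  proof -
    have sub: "R \<union> S \<subseteq> Y" "R \<union> S \<noteq> {}" "R \<inter> S \<subseteq> Y" using that by (auto simp: tight_def)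
    show ?thesis
      using that sub sparse[OF sub(1,2)] sparse[OF sub(3) that(3)] inside_supermodular[of M R S] card_mod[of R S]
      by (auto simp: tight_def)
  qed
  have full_Int: "full (R \<inter> S)" if "full R" "full S" "R \<inter> S \<noteq> {}" for R S
  proof -
    have sub: "R \<union> S \<subseteq> Y" "R \<union> S \<noteq> {}" "R \<inter> S \<subseteq> Y" using that by (auto simp: full_def)
    have "R \<subseteq> Y" "S \<subseteq> Y" "inside M R + 3 + hits N R = 3 * card R + k"
      "inside M S + 3 + hits N S = 3 * card S + k" using that by (auto simp: full_def)
    then show ?thesis
      using that(3) sub sparse_hits[OF sub(1,2)] sparse_hits[OF sub(3) that(3)] inside_supermodular[of M R S]
        card_mod[of R S] hits_modular[of N R S]
      unfolding full_def by linarith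
  qed
  \<comment> \<open>Comparing the two sparsity conditions: a full set holds at least
    \<open>k\<close> entries of \<open>N\<close>, a tight set at most \<open>k\<close>.\<close>
  have full_hits: "k \<le> hits N R" if "full R" for R
    using that sparse[of R] by (auto simp: full_def)
  have tight_hits: "hits N R \<le> k" if "tight R" for R
    using that sparse_hits[of R] by (auto simp: tight_def)
  have k: "0 < k" using size by simp
  have elem_not_hit: "\<exists>x \<in># N. x \<notin> R" if "hits N R < size N" for R
  proof (rule ccontr)
    assume "\<not> ?thesis"
    then have "filter_mset (\<lambda>x. x \<in> R) N = N" by (simp add: filter_mset_eq_conv)
    then show False using that by (simp add: hits_def)
  qed
  have fin: "finite {R. R \<subseteq> Y \<and> P R}" for P
    using Y by (rule rev_finite_subset[OF finite_Pow_iff[THEN iffD2]]) auto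
  \<comment> \<open>A largest tight set \<open>T\<close> through \<open>a\<close> contains all the
    others. It holds at most \<open>k\<close> of the more than \<open>k\<close> entries of
    \<open>N\<close>, so a partner outside \<open>T\<close> exists. If \<open>a\<close> is not in
    \<open>Y\<close>, no tight set contains it.\<close>
  have partner: "\<exists>b N'. N = add_mset a (add_mset b N') \<and> (\<forall>R. tight R \<longrightarrow> a \<in> R \<longrightarrow> b \<notin> R)"
    if a: "a \<in># N" for a
  proof -
    obtain N1 where N1: "N = add_mset a N1" using a by (metis mset_add)
    show ?thesis
    proof (cases "a \<in> Y")
      case False
      have "N1 \<noteq> {#}" using N1 size k by auto
      then obtain b N' where "N1 = add_mset b N'" by (meson multiset_cases)
      then show ?thesis using N1 False by (auto simp: tight_def)
    next
      case True
      have "tight {a}" using True sparse[of "{a}"] by (simp add: tight_def)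
      then have "{a} \<in> {R. R \<subseteq> Y \<and> (tight R \<and> a \<in> R)}" using True by simp
      from finite_has_maximal2[OF fin this] obtain T where T0: "T \<in> {R. R \<subseteq> Y \<and> (tight R \<and> a \<in> R)}"
        and max: "\<forall>R \<in> {R. R \<subseteq> Y \<and> (tight R \<and> a \<in> R)}. T \<subseteq> R \<longrightarrow> T = R"
        by (elim bexE conjE)
      have T: "tight T" "a \<in> T" using T0 by auto
      have sub: "R \<subseteq> T" if "tight R" "a \<in> R" for R
      proof -
        have "tight (T \<union> R)" using tight_Un[OF T(1) that(1)] that(2) T(2) by blast
        moreover have "T \<union> R \<subseteq> Y" using T(1) that(1) by (simp add: tight_def)
        ultimately have "T = T \<union> R" using max T(2) by simp
        then show ?thesis by blast
      qed
      have "hits N T < size N" using tight_hits[OF T(1)] size by simp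
      then obtain b where b: "b \<in># N" "b \<notin> T"
        using elem_not_hit by blast
      then have "b \<in># N1" using N1 T(2) by auto
      then obtain N' where "N1 = add_mset b N'" by (metis mset_add)
      then show ?thesis using N1 sub b(2) by blast
    qed
  qed
  have finish: thesis
    if "N = add_mset a (add_mset b N')" "\<And>R. tight R \<Longrightarrow> a \<in> R \<Longrightarrow> b \<notin> R"
      "\<And>R. full R \<Longrightarrow> a \<in> R \<or> b \<in> R" for a b N'
  proof (rule choose[OF that(1)])
    fix R assume R: "R \<subseteq> Y" "a \<in> R" "b \<in> R"
    then have "\<not> tight R" "R \<noteq> {}" using that(2) by blast+
    then show "inside M R + 4 \<le> 3 * card R" using sparse[OF R(1)] R(1) by (simp add: tight_def)
  next
    fix R assume R: "R \<subseteq> Y" "R \<noteq> {}" "a \<notin> R" "b \<notin> R"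
    then have "\<not> full R" using that(3) by blast
    then show "inside M R + 4 + hits N R \<le> 3 * card R + k"
      using sparse_hits[OF R(1,2)] R(1,2) by (simp add: full_def)
  qed
  have elem: "\<exists>a \<in># N. a \<in> R" if "0 < hits N R" for R
  proof -
    have "filter_mset (\<lambda>x. x \<in> R) N \<noteq> {#}" using that unfolding hits_def by (metis less_irrefl size_empty)
    then obtain x where "x \<in># filter_mset (\<lambda>x. x \<in> R) N" by blast
    then show ?thesis by auto
  qed
  show thesis
  proof (cases "\<exists>R. full R")
    case False
    have "N \<noteq> {#}" using size by auto
    then obtain a where "a \<in># N" by blast
    from partner[OF this] obtain b N' where
      "N = add_mset a (add_mset b N')" "\<forall>R. tight R \<longrightarrow> a \<in> R \<longrightarrow> b \<notin> R" by (elim exE conjE)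
    then show thesis using False by (intro finish[of a b N']) auto
  next
    case True
    then obtain R0 where "full R0" by blast
    then have "R0 \<in> {R. R \<subseteq> Y \<and> full R}" by (simp add: full_def)
    from finite_has_minimal2[OF fin this] obtain R1 where R10: "R1 \<in> {R. R \<subseteq> Y \<and> full R}"
      and min10: "\<forall>R \<in> {R. R \<subseteq> Y \<and> full R}. R \<subseteq> R1 \<longrightarrow> R1 = R"
      by (elim bexE conjE)
    have R1: "full R1" using R10 by simp
    have min1: "R = R1" if "full R" "R \<subseteq> R1" for R
    proof -
      have "R \<in> {R. R \<subseteq> Y \<and> full R}" using that R10 by auto
      from bspec[OF min10 this] that(2) show ?thesis by simp
    qed
    have contains1: "R1 \<subseteq> R" if "full R" "R \<inter> R1 \<noteq> {}" for R
      using min1[OF full_Int[OF that(1) R1 that(2)]] by blast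
    obtain a where a: "a \<in># N" "a \<in> R1" using elem[of R1] full_hits[OF R1] k by auto
    show thesis
    proof (cases "\<exists>R. full R \<and> R \<inter> R1 = {}")
      case False
      then have aR: "a \<in> R" if "full R" for R using contains1[OF that] that a(2) by auto
      from partner[OF a(1)] obtain b N' where
        "N = add_mset a (add_mset b N')" "\<forall>R. tight R \<longrightarrow> a \<in> R \<longrightarrow> b \<notin> R" by (elim exE conjE)
      then show thesis using aR by (intro finish[of a b N']) auto
    next
      case True
      then obtain R0 where "full R0" "R0 \<inter> R1 = {}" by blast
      then have "R0 \<in> {R. R \<subseteq> Y \<and> (full R \<and> R \<inter> R1 = {})}" by (simp add: full_def)
      from finite_has_minimal2[OF fin this] obtain R2 where R20: "R2 \<in> {R. R \<subseteq> Y \<and> (full R \<and> R \<inter> R1 = {})}"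
        and min20: "\<forall>R \<in> {R. R \<subseteq> Y \<and> (full R \<and> R \<inter> R1 = {})}. R \<subseteq> R2 \<longrightarrow> R2 = R"
        by (elim bexE conjE)
      have R2: "full R2" "R2 \<inter> R1 = {}" using R20 by simp_all
      have min2: "R = R2" if "full R" "R \<inter> R1 = {}" "R \<subseteq> R2" for R
      proof -
        have "R \<in> {R. R \<subseteq> Y \<and> (full R \<and> R \<inter> R1 = {})}" using that R20 by auto
        from bspec[OF min20 this] that(3) show ?thesis by simp
      qed
      obtain b where b: "b \<in># N" "b \<in> R2" using elem[of R2] full_hits[OF R2(1)] k by auto
      have ab: "a \<noteq> b" using a b R2(2) by blast
      obtain N1 where N1: "N = add_mset a N1" using a(1) by (metis mset_add)
      then have "b \<in># N1" using ab b(1) by auto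
      then obtain N' where N': "N = add_mset a (add_mset b N')" using N1 by (metis mset_add)
      have disj: "hits N R + hits N S \<le> 2 * k" if "R \<inter> S = {}" for R S
        using hits_modular[of N R S] hits_le_size[of N "R \<union> S"] size that
        by (simp add: hits_def[of N "{}"])
      \<comment> \<open>The two disjoint full sets share at most \<open>2 * k\<close> entries, hence
        hold exactly \<open>k\<close> each, and \<open>R1\<close> is tight. A tight set through
        \<open>a\<close> and \<open>b\<close> would unite with \<open>R1\<close> to a tight set with
        more than \<open>k\<close> entries.\<close>
      have hits1: "hits N R1 = k"
        using disj[of R1 R2] R2(2) full_hits[OF R1] full_hits[OF R2(1)] by (simp add: Int_commute)
      then have tight1: "tight R1" using R1 by (simp add: full_def tight_def)
      show thesis
      proof (rule finish[OF N'])
        fix R assume R: "tight R" "a \<in> R"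
        show "b \<notin> R"
        proof
          assume "b \<in> R"
          have "tight (R1 \<union> R)" using tight_Un[OF tight1 R(1)] a(2) R(2) by blast
          then have "hits N (R1 \<union> R) \<le> k" by (rule tight_hits)
          moreover have "hits N R1 + hits N {b} = hits N (insert b R1)"
            using hits_modular[of N R1 "{b}"] b(2) R2(2) by (auto simp: hits_def)
          moreover have "hits N (insert b R1) \<le> hits N (R1 \<union> R)"
            using \<open>b \<in> R\<close> by (intro hits_mono) auto
          moreover have "0 < hits N {b}" using N' by simp
          ultimately show False using hits1 by simp
        qed
      next
        fix R assume R: "full R"
        \<comment> \<open>A full set meeting \<open>R1\<close> or \<open>R2\<close> contains it by
          minimality; one disjoint from both would force \<open>3 * k\<close> entries.\<close>
        show "a \<in> R \<or> b \<in> R"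
        proof (cases "R \<inter> R1 = {}")
          case False then show ?thesis using contains1[OF R] a(2) by blast
        next
          case d1: True
          show ?thesis
          proof (cases "R \<inter> R2 = {}")
            case False
            then have "R \<inter> R2 = R2" using min2[OF full_Int[OF R R2(1)]] R2(2) by blast
            then show ?thesis using b(2) by blast
          next
            case True
            have "hits N R + hits N (R1 \<union> R2) \<le> 2 * k" using disj d1 True by (metis Int_Un_distrib Un_empty)
            moreover have "hits N (R1 \<union> R2) = hits N R1 + hits N R2"
              using hits_modular[of N R1 R2] R2(2) by (simp add: hits_def[of N "{}"] Int_commute)
            ultimately show ?thesis using full_hits[OF R] full_hits[OF R1] full_hits[OF R2(1)] k by simp
          qed
        qed
      qed
    qed
  qed
qed

text \<open>
  \<open>N\<close> lists the neighbours of the vertex to be removed and \<open>M\<close> the edges avoiding it. With \<open>k = 3\<close> the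
  second sparsity condition is the sparsity of \<open>R\<close> together with that vertex; each split
  lowers \<open>k\<close> by one.
\<close>
lemma split_off_keeping_sparse:
  assumes "finite Y"
    and "\<And>R. R \<subseteq> Y \<Longrightarrow> R \<noteq> {} \<Longrightarrow> inside M R + 3 \<le> 3 * card R"
    and "\<And>R. R \<subseteq> Y \<Longrightarrow> R \<noteq> {} \<Longrightarrow> inside M R + 3 + hits N R \<le> 3 * card R + k"
    and "size N = k + r" "r \<le> k"
  shows "\<exists>L N'. N = image_mset fst L + image_mset snd L + N' \<and> size L = r \<and>
    (\<forall>R. R \<subseteq> Y \<longrightarrow> R \<noteq> {} \<longrightarrow> inside (M + image_mset ends L) R + 3 \<le> 3 * card R)"
  using assms
proof (induction r arbitrary: k M N)
  case 0
  then show ?case by (intro exI[of _ "{#}"] exI[of _ N]) simp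
next
  case (Suc r)
  have "k < size N" "size N \<le> 2 * k" using Suc.prems(4,5) by auto
  from splittable_pair[OF Suc.prems(1-3) this] obtain a b N1
    where N1: "N = add_mset a (add_mset b N1)"
      and in2: "\<And>R. R \<subseteq> Y \<Longrightarrow> a \<in> R \<Longrightarrow> b \<in> R \<Longrightarrow> inside M R + 4 \<le> 3 * card R"
      and out2: "\<And>R. R \<subseteq> Y \<Longrightarrow> R \<noteq> {} \<Longrightarrow> a \<notin> R \<Longrightarrow> b \<notin> R \<Longrightarrow> inside M R + 4 + hits N R \<le> 3 * card R + k"
    by metis
  let ?M = "M + {#ends (a, b)#}"
  have ins: "inside ?M R = inside M R + (if a \<in> R \<and> b \<in> R then 1 else 0)" for R
    by (auto simp: inside_def ends_def)
  have 1: "inside ?M R + 3 \<le> 3 * card R" if "R \<subseteq> Y" "R \<noteq> {}" for R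
    using in2[OF that(1)] Suc.prems(2)[OF that] unfolding ins by auto
  \<comment> \<open>With both \<open>a\<close> and \<open>b\<close> in \<open>R\<close>, the new
    edge adds 1 and \<open>hits\<close> drops by 2; with exactly one in \<open>R\<close>,
    \<open>hits\<close> drops by 1; with neither, \<open>out2\<close> supplies the missing
    unit.\<close>
  have 2: "inside ?M R + 3 + hits N1 R \<le> 3 * card R + (k - 1)" if "R \<subseteq> Y" "R \<noteq> {}" for R
    using out2[OF that] Suc.prems(3)[OF that] Suc.prems(5) unfolding ins N1 by (cases "a \<in> R"; cases "b \<in> R") auto
  obtain L N' where L: "N1 = image_mset fst L + image_mset snd L + N'" "size L = r"
    "\<forall>R. R \<subseteq> Y \<longrightarrow> R \<noteq> {} \<longrightarrow> inside (?M + image_mset ends L) R + 3 \<le> 3 * card R"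
  proof -
    have "size N1 = k - 1 + r" "r \<le> k - 1" using Suc.prems(4,5) N1 by auto
    from Suc.IH[OF Suc.prems(1) 1 2 this] show thesis using that by blast
  qed
  show ?case
    by (rule exI[of _ "add_mset (a, b) L"], rule exI[of _ N'])
      (use L N1 in \<open>auto simp: add.assoc\<close>)
qed

section \<open>Critical instances\<close>

text \<open>Orienting and deleting an edge shifts the boundary at its ends but also lowers their
  degrees, so a vertex still of degree 6 keeps boundary 0. In this form the degree clause survives
  every reduction.\<close>

definition admissible :: "'v set \<Rightarrow> 'v set multiset \<Rightarrow> ('v \<Rightarrow> int) \<Rightarrow> bool" where
  "admissible X U b \<longleftrightarrow> finite X \<and> (\<forall>e \<in># U. card e = 2 \<and> e \<inter> X \<noteq> {}) \<and>
     (\<forall>x \<in> X. degr U x \<le> 5 \<or> degr U x = 6 \<and> 3 dvd b x) \<and>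
     (\<forall>S. S \<subseteq> X \<longrightarrow> S \<noteq> {} \<longrightarrow> inside U S + 3 \<le> 3 * card S)"

definition critical :: "'v set \<Rightarrow> 'v set multiset \<Rightarrow> ('v \<Rightarrow> int) \<Rightarrow> bool" where
  "critical X U b \<longleftrightarrow> \<not> orientable X U b \<and> (\<forall>Y. Y \<subset> X \<longrightarrow> orientable Y (touching U Y) b)"

section \<open>Degree counts, orienting a cut, and passing to critical instances\<close>

lemma filter_mset_empty_iff: "filter_mset P M = {#} \<longleftrightarrow> (\<forall>x \<in># M. \<not> P x)"
  by (induction M) auto

lemma degr_touching: "x \<in> Y \<Longrightarrow> degr (touching U Y) x = degr U x"
  unfolding degr_def touching_def filter_filter_mset by (rule arg_cong[where f = size], rule filter_mset_cong) auto

lemma degr_le_filter: "degr (filter_mset P U) x \<le> degr U x"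
  unfolding degr_def filter_filter_mset by (rule size_filter_mset_mono) auto

lemma inside_le_filter: "inside (filter_mset P U) S \<le> inside U S"
  unfolding inside_def filter_filter_mset by (rule size_filter_mset_mono) auto

lemma size_touching_avoiding: "size U = size (touching U S) + size (avoiding U S)"
  by (metis size_union touching_plus_avoiding)

lemma net_eq_0: "(\<And>e. e \<in># image_mset ends A \<Longrightarrow> x \<notin> e) \<Longrightarrow> net A x = 0"
proof -
  assume "\<And>e. e \<in># image_mset ends A \<Longrightarrow> x \<notin> e"
  then have "x \<notin># image_mset fst A" "x \<notin># image_mset snd A" by (auto simp: ends_def)
  then show ?thesis unfolding not_in_iff by (simp add: net_def)
qed

lemma degr_eq_0: "degr U x = 0 \<Longrightarrow> e \<in># U \<Longrightarrow> x \<notin> e"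
  unfolding degr_def by (metis filter_mset_empty_iff size_eq_0_iff_empty)

lemma sum_degr:
  assumes "finite S"
  shows "(\<Sum>x \<in> S. degr U x) = (\<Sum>e \<in># U. card (e \<inter> S))"
proof (induction U)
  case (add e U)
  have "(\<Sum>x \<in> S. degr (add_mset e U) x) = (\<Sum>x \<in> S. degr U x + (if x \<in> e then 1 else 0))"
    by (intro sum.cong) (auto simp: degr_def)
  moreover have "(\<Sum>x \<in> S. if x \<in> e then 1 else 0) = card (e \<inter> S)"
    using assms by (simp add: sum.If_cases Int_commute)
  ultimately show ?case using add by (simp add: sum.distrib)
qed (simp add: degr_def)

lemma degr_image_ends:
  assumes "\<forall>p \<in># L. fst p \<noteq> snd p"
  shows "degr (image_mset ends L) x = count (image_mset fst L) x + count (image_mset snd L) x"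
  using assms by (induction L) (auto simp: degr_def ends_def)

lemma size_filter_ends:
  "2 * size (avoiding (image_mset ends L) T)
    \<le> size (filter_mset (\<lambda>x. x \<notin> T) (image_mset fst L + image_mset snd L))"
  by (induction L) (auto simp: avoiding_def ends_def)

lemma degr_image_pair: "x \<noteq> v \<Longrightarrow> degr (image_mset (\<lambda>x. {v, x}) N) x = count N x"
  by (induction N) (auto simp: degr_def)

lemma avoiding_image_pair:
  "v \<notin> T \<Longrightarrow> size (avoiding (image_mset (\<lambda>x. {v, x}) N) T) = size (filter_mset (\<lambda>x. x \<notin> T) N)"
  by (induction N) (auto simp: avoiding_def)

lemma inside_image_pair:
  "inside (image_mset (\<lambda>x. {v, x}) N) R = (if v \<in> R then hits N R else 0)"
  by (induction N) (auto simp: inside_def hits_def)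

lemma orient_outwards:
  assumes "\<forall>e \<in># F. card e = 2 \<and> e \<inter> X \<noteq> {} \<and> \<not> e \<subseteq> X"
  shows "\<exists>A. image_mset ends A = F \<and> (\<forall>a \<in># A. fst a \<in> X \<and> snd a \<notin> X)"
  using assms
proof (induction F)
  case (add e F)
  then obtain A where A: "image_mset ends A = F" "\<forall>a \<in># A. fst a \<in> X \<and> snd a \<notin> X" by auto
  have "card e = 2" "e \<inter> X \<noteq> {}" "\<not> e \<subseteq> X" using add.prems by auto
  then obtain x y where "e = {x, y}" "x \<in> X" "y \<notin> X" by (auto simp: card_2_iff)
  then show ?case using A by (intro exI[of _ "add_mset (x, y) A"]) (auto simp: ends_def[of "(x, y)"])
qed auto

text \<open>Starting with all cut edges directed away from \<open>X\<close>, reversing a suitable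
  part \<open>Q\<close> gives \<open>X\<close> any total net modulo 3. This serves to delete a root
  of degree 2.\<close>

lemma orient_cut_with_residue:
  assumes X: "finite X" and F: "\<forall>e \<in># F. card e = 2 \<and> e \<inter> X \<noteq> {} \<and> \<not> e \<subseteq> X"
    and size: "2 \<le> size F"
  obtains A where "image_mset ends A = F" "3 dvd c - (\<Sum>x \<in> X. net A x)"
proof -
  obtain A where A: "image_mset ends A = F" "\<forall>a \<in># A. fst a \<in> X \<and> snd a \<notin> X"
    using orient_outwards[OF F] by blast
  have "2 \<le> size A" using size A(1) by (metis size_image_mset)
  then obtain P Q where PQ: "A = P + Q" "3 dvd c - (int (size P) - int (size Q))"
    using split_with_residue[of A c] by blast
  have sum: "(\<Sum>x \<in> X. net B x) = int (size B)" if "\<forall>a \<in># B. fst a \<in> X \<and> snd a \<notin> X" for B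
  proof -
    have "filter_mset (\<lambda>a. fst a \<in> X) B = B" "filter_mset (\<lambda>a. snd a \<in> X) B = {#}"
      using that by (auto simp: filter_mset_eq_conv filter_mset_empty_iff)
    then show ?thesis
      unfolding net_def sum_subtractf of_nat_sum[symmetric] sum_count[OF X]
      by (simp add: filter_mset_image_mset)
  qed
  have swap: "net (image_mset prod.swap Q) x = - net Q x" for x
    by (simp add: net_def multiset.map_comp comp_def)
  have "ends \<circ> prod.swap = ends" by (auto simp: ends_def fun_eq_iff)
  then have "image_mset ends (P + image_mset prod.swap Q) = F"
    using A(1) PQ(1) by (metis image_mset_union multiset.map_comp)
  moreover have "(\<Sum>x \<in> X. net (P + image_mset prod.swap Q) x) = int (size P) - int (size Q)"
    using sum[of P] sum[of Q] A(2) PQ(1) by (simp add: swap sum_subtractf)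
  ultimately show thesis using that PQ(2) by metis
qed

text \<open>A minimal \<open>Y\<close> on which orientation fails is critical, so
  \<open>bound\<close> controls the edges meeting \<open>Y\<close>. The others are spanned by
  \<open>X - Y\<close> and the root, and \<open>sparse\<close> allows three of them per
  vertex.\<close>

lemma bound_from_critical:
  assumes adm: "admissible X U b" and nori: "\<not> orientable X U b"
    and sparse: "\<And>W. W \<subset> X \<Longrightarrow> size (avoiding U (X - W)) \<le> 3 * card W"
    and bound: "\<And>Y W. Y \<subseteq> X \<Longrightarrow> admissible Y W b \<Longrightarrow> critical Y W b \<Longrightarrow> size W + 2 \<le> 3 * card Y"
  shows "size U + 2 \<le> 3 * card X"
proof -
  have fin: "finite X" using adm by (simp add: admissible_def)
  have "touching U X = U" using adm by (intro touching_self) (simp add: admissible_def)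
  then have "X \<in> {Y. Y \<subseteq> X \<and> \<not> orientable Y (touching U Y) b}" using nori by simp
  moreover have "finite {Y. Y \<subseteq> X \<and> \<not> orientable Y (touching U Y) b}"
    using fin by (auto intro: rev_finite_subset[of "Pow X"])
  ultimately obtain Y where Y0: "Y \<in> {Y. Y \<subseteq> X \<and> \<not> orientable Y (touching U Y) b}"
    and min: "\<forall>Z \<in> {Y. Y \<subseteq> X \<and> \<not> orientable Y (touching U Y) b}. Z \<subseteq> Y \<longrightarrow> Y = Z"
    using finite_has_minimal2 by (metis (no_types, lifting))
  have Y: "Y \<subseteq> X" "\<not> orientable Y (touching U Y) b" using Y0 by simp_all
  have crit: "critical Y (touching U Y) b"
    unfolding critical_def
  proof (intro conjI allI impI)
    fix Z assume Z: "Z \<subset> Y"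
    then have "Z \<notin> {Y. Y \<subseteq> X \<and> \<not> orientable Y (touching U Y) b}" using bspec[OF min, of Z] by blast
    then show "orientable Z (touching (touching U Y) Z) b"
      using Z Y(1) touching_touching[of Z Y U] by auto
  qed (rule Y(2))
  have "admissible Y (touching U Y) b"
    unfolding admissible_def
  proof (intro conjI ballI allI impI)
    show "finite Y" using Y(1) fin by (rule finite_subset)
  next
    fix e assume e: "e \<in># touching U Y"
    then have "e \<in># U" by (simp add: touching_def)
    then show "card e = 2" using adm by (simp add: admissible_def)
    show "e \<inter> Y \<noteq> {}" using e by (simp add: touching_def)
  next
    fix x assume "x \<in> Y"
    then show "degr (touching U Y) x \<le> 5 \<or> degr (touching U Y) x = 6 \<and> 3 dvd b x"
      using adm Y(1) by (auto simp: admissible_def degr_touching)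
  next
    fix S assume S: "S \<subseteq> Y" "S \<noteq> {}"
    then have "inside U S + 3 \<le> 3 * card S" using adm Y(1) unfolding admissible_def by blast
    then show "inside (touching U Y) S + 3 \<le> 3 * card S"
      using inside_le_filter[of _ U S] unfolding touching_def by (meson add_le_mono1 order_trans)
  qed
  then have 1: "size (touching U Y) + 2 \<le> 3 * card Y" using bound[OF Y(1) _ crit] by blast
  have "\<forall>e \<in># U. card e = 2" using adm by (simp add: admissible_def)
  then have "Y \<noteq> {}" using Y(2) orientable_empty[of "touching U {}" b] by (auto simp: touching_def)
  then have "X - Y \<subset> X" using Y(1) by blast
  from sparse[OF this] have "size (avoiding U Y) \<le> 3 * card (X - Y)"
    using Y(1) by (simp add: double_diff)
  moreover have "card X = card Y + card (X - Y)"
    using Y(1) fin by (metis card_Diff_subset card_mono finite_subset le_add_diff_inverse)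
  ultimately show ?thesis using 1 size_touching_avoiding[of U Y] by linarith
qed

text \<open>The reductions yield non-orientable instances that need not be critical, so
  \<open>smaller\<close> asks for the bound on those; its last premise is the sparsity around the
  root used by \<open>bound_from_critical\<close>.\<close>

locale least_critical =
  fixes X :: "'v set" and U :: "'v set multiset" and b :: "'v \<Rightarrow> int"
  assumes adm: "admissible X U b"
    and crit: "critical X U b"
    and smaller: "\<And>(Y :: 'v set) W c. card Y < card X \<Longrightarrow> admissible Y W c \<Longrightarrow> \<not> orientable Y W c \<Longrightarrow>
      (\<And>Z. Z \<subset> Y \<Longrightarrow> size (avoiding W (Y - Z)) \<le> 3 * card Z) \<Longrightarrow> size W + 2 \<le> 3 * card Y"
begin

lemma finite_X: "finite X"
  using adm by (simp add: admissible_def)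

lemma card_edge: "e \<in># U \<Longrightarrow> card e = 2"
  using adm by (simp add: admissible_def)

lemma edge_meets: "e \<in># U \<Longrightarrow> e \<inter> X \<noteq> {}"
  using adm by (simp add: admissible_def)

lemma degrees: "x \<in> X \<Longrightarrow> degr U x \<le> 5 \<or> degr U x = 6 \<and> 3 dvd b x"
  using adm by (simp add: admissible_def)

lemma sparse: "S \<subseteq> X \<Longrightarrow> S \<noteq> {} \<Longrightarrow> inside U S + 3 \<le> 3 * card S"
  using adm by (simp add: admissible_def)

lemma avoiding_X: "avoiding U X = {#}"
  using edge_meets by (auto simp: avoiding_def filter_mset_empty_iff)

text \<open>Criticality orients the edges meeting \<open>X - W\<close>; deleting them leaves a
  non-orientable instance on \<open>W\<close>, to which \<open>smaller\<close> applies. Induction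
  over subsets of \<open>W\<close> supplies its sparsity premise.\<close>

lemma avoiding_bound:
  assumes "W \<subset> X" "W \<noteq> {}"
  shows "size (avoiding U (X - W)) + 2 \<le> 3 * card W"
  using finite_subset[OF psubset_imp_subset[OF assms(1)] finite_X] assms
proof (induction W rule: finite_psubset_induct)
  case (psubset W)
  let ?S = "X - W"
  have "?S \<subset> X" using psubset.prems by blast
  then have "orientable ?S (touching U ?S) b" using crit unfolding critical_def by blast
  then obtain A where A: "image_mset ends A = touching U ?S" "\<forall>x \<in> ?S. 3 dvd net A x - b x"
    unfolding orientable_def by blast
  let ?c = "\<lambda>x. b x - net A x"
  have nori: "\<not> orientable W (avoiding U ?S) ?c"
  proof
    assume "orientable W (avoiding U ?S) ?c"
    then obtain B where B: "image_mset ends B = avoiding U ?S" "\<forall>x \<in> W. 3 dvd net B x - ?c x"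
      unfolding orientable_def by blast
    have "orientable X (touching U ?S + avoiding U ?S) b"
    proof (rule orientable_union[OF A(1)])
      have "net B x = 0" if "x \<in> ?S" for x
        by (rule net_eq_0) (use that in \<open>auto simp: B(1) avoiding_def\<close>)
      then have "3 dvd net B x - ?c x" if "x \<in> X" for x
        using A(2) B(2) that by (cases "x \<in> W") auto
      then show "orientable X (avoiding U ?S) ?c" using B(1) unfolding orientable_def by blast
    qed
    then show False using crit by (simp add: touching_plus_avoiding critical_def)
  qed
  have adm': "admissible W (avoiding U ?S) ?c"
    unfolding admissible_def
  proof (intro conjI ballI allI impI)
    show "finite W" by fact
  next
    fix e assume e: "e \<in># avoiding U ?S"
    then have "e \<in># U" "e \<inter> ?S = {}" by (auto simp: avoiding_def)
    then show "card e = 2" "e \<inter> W \<noteq> {}" using card_edge edge_meets[of e] by auto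
  next
    fix x assume x: "x \<in> W"
    then have xX: "x \<in> X" using psubset.prems by blast
    have split: "degr U x = degr (touching U ?S) x + degr (avoiding U ?S) x"
      by (metis degr_union touching_plus_avoiding)
    \<comment> \<open>Degree 6 survives only if no oriented edge meets \<open>x\<close>, and then
      the boundary at \<open>x\<close> is unchanged.\<close>
    show "degr (avoiding U ?S) x \<le> 5 \<or> degr (avoiding U ?S) x = 6 \<and> 3 dvd ?c x"
    proof (cases "degr (avoiding U ?S) x \<le> 5")
      case False
      then have 6: "degr (avoiding U ?S) x = 6" "3 dvd b x" "degr (touching U ?S) x = 0"
        using degrees[OF xX] split by auto
      have "net A x = 0" using degr_eq_0[OF 6(3)] by (intro net_eq_0) (simp add: A(1))
      then show ?thesis using 6 by simp
    qed simp
  next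
    fix S assume "S \<subseteq> W" "S \<noteq> {}"
    then have "inside U S + 3 \<le> 3 * card S" using sparse psubset.prems(1) by blast
    then show "inside (avoiding U ?S) S + 3 \<le> 3 * card S"
      using inside_le_filter[of _ U S] unfolding avoiding_def by (meson add_le_mono1 order_trans)
  qed
  show ?case
  proof (rule smaller[OF psubset_card_mono[OF finite_X psubset.prems(1)] adm' nori])
    fix Z assume Z: "Z \<subset> W"
    have eq: "avoiding (avoiding U ?S) (W - Z) = avoiding U (X - Z)"
      unfolding avoiding_def filter_filter_mset by (rule filter_mset_cong) (use Z psubset.prems in auto)
    show "size (avoiding (avoiding U ?S) (W - Z)) \<le> 3 * card Z"
    proof (cases "Z = {}")
      case True
      then show ?thesis unfolding eq by (simp add: avoiding_X)
    next
      case False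
      have "Z \<subset> X" using Z psubset.prems(1) by blast
      from psubset.IH[OF Z this False] show ?thesis unfolding eq by simp
    qed
  qed
qed

lemma root_edges_le_1:
  assumes "w \<in> X"
  shows "size (filter_mset (\<lambda>e. e \<inter> X = {w}) U) \<le> 1"
proof (rule ccontr)
  assume "\<not> ?thesis"
  then have "2 \<le> size (filter_mset (\<lambda>e. e \<inter> X = {w}) U)" by simp
  moreover have "X - {w} \<subset> X" using assms by blast
  then have "orientable (X - {w}) (touching U (X - {w})) b" using crit unfolding critical_def by blast
  ultimately have "orientable X U b"
    using orientable_two_root_edges[of U X w b] assms card_edge edge_meets by blast
  then show False using crit by (simp add: critical_def)
qed

end

lemma size_ge_1: "x \<in># M \<Longrightarrow> 1 \<le> size M"
  by (cases M) auto

section \<open>Reductions in a least counterexample\<close>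

locale dense_least_critical = least_critical +
  assumes dense: "3 * card X < size U + 2"
begin

text \<open>Adding \<open>v\<close> to \<open>Z\<close> in \<open>avoiding_bound\<close> gives
  \<open>3 * (card Z + 1) - 2\<close>. This exceeds by one the \<open>3 * card Z\<close> that
  \<open>smaller\<close> demands, so each reduction must save one further edge.\<close>

lemma avoiding_bound_insert:
  assumes "v \<in> X" "Z \<subset> X - {v}"
  shows "size (avoiding U (X - {v} - Z)) \<le> 3 * card Z + 1"
proof -
  have "insert v Z \<subset> X" using assms by blast
  from avoiding_bound[OF this] have "size (avoiding U (X - insert v Z)) + 2 \<le> 3 * card (insert v Z)"
    by simp
  moreover have "card (insert v Z) = Suc (card Z)"
    using assms finite_X by (metis Diff_subset card_insert_disjoint finite_subset insertCI psubset_imp_subset subset_Diff_insert)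
  moreover have "X - insert v Z = X - {v} - Z" by blast
  ultimately show ?thesis by simp
qed

text \<open>At most \<open>3 * (card X - 1) - 2\<close> edges miss \<open>v\<close>, while a
  counterexample has at least \<open>3 * card X - 1\<close>. If \<open>X = {v}\<close>, all edges
  join \<open>v\<close> to the root, so there is at most one.\<close>

lemma degr_ge_4:
  assumes v: "v \<in> X"
  shows "4 \<le> degr U v"
proof -
  have "touching U {v} = filter_mset (\<lambda>e. v \<in> e) U"
    unfolding touching_def by (rule filter_mset_cong) auto
  then have size: "size U = degr U v + size (avoiding U {v})"
    using size_touching_avoiding[of U "{v}"] by (simp add: degr_def)
  show ?thesis
  proof (cases "X = {v}")
    case True
    then have "filter_mset (\<lambda>e. e \<inter> X = {v}) U = U"
      using edge_meets by (auto simp: filter_mset_eq_conv)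
    then have "size U \<le> 1" using root_edges_le_1[OF v] by simp
    then show ?thesis using dense True by simp
  next
    case False
    then have "X - {v} \<subset> X" "X - {v} \<noteq> {}" using v by auto
    from avoiding_bound[OF this] have "size (avoiding U {v}) + 2 \<le> 3 * (card X - 1)"
      using v finite_X by (simp add: double_diff)
    moreover have "0 < card X" using v finite_X by (auto simp: card_gt_0_iff)
    ultimately show ?thesis using dense size by simp
  qed
qed

text \<open>The last clause says that at most one edge joins \<open>v\<close> to the root; hence a
  split-off pair never becomes an edge with both ends at the root.\<close>

lemma obtain_star:
  assumes v: "v \<in> X"
  obtains M N where "U = M + image_mset (\<lambda>x. {v, x}) N" "v \<notin># N" "\<forall>e \<in># M. v \<notin> e"
    "size N = degr U v"
    "\<forall>e \<in># M. e \<inter> (X - {v}) \<noteq> {}"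
    "\<forall>a c N'. N = add_mset a (add_mset c N') \<longrightarrow> a \<in> X \<or> c \<in> X"
proof -
  obtain N where N: "filter_mset (\<lambda>e. v \<in> e) U = image_mset (\<lambda>x. {v, x}) N" "v \<notin># N"
    using obtain_neighbours[of U v] card_edge by blast
  let ?M = "filter_mset (\<lambda>e. v \<notin> e) U"
  show thesis
  proof (rule that[of ?M N])
    show "U = ?M + image_mset (\<lambda>x. {v, x}) N"
      unfolding N(1)[symmetric] by (metis add.commute multiset_partition)
    show "size N = degr U v" unfolding degr_def N(1) by simp
    show "\<forall>e \<in># ?M. e \<inter> (X - {v}) \<noteq> {}"
    proof
      fix e assume "e \<in># ?M"
      then show "e \<inter> (X - {v}) \<noteq> {}" using edge_meets[of e] by auto
    qed
    show "\<forall>a c N'. N = add_mset a (add_mset c N') \<longrightarrow> a \<in> X \<or> c \<in> X"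
    proof (intro allI impI, rule ccontr)
      fix a c N'
      assume N': "N = add_mset a (add_mset c N')"
      assume "\<not> (a \<in> X \<or> c \<in> X)"
      then have "{v, a} \<inter> X = {v}" "{v, c} \<inter> X = {v}" using v by auto
      then have "2 \<le> size (filter_mset (\<lambda>e. e \<inter> X = {v}) (filter_mset (\<lambda>e. v \<in> e) U))"
        unfolding N(1) N' by simp
      also have "\<dots> \<le> size (filter_mset (\<lambda>e. e \<inter> X = {v}) U)"
        unfolding filter_filter_mset by (rule size_filter_mset_mono) simp
      finally show False using root_edges_le_1[OF v] by simp
    qed
  qed (use N in auto)
qed

lemma degr_eq_5:
  assumes v: "v \<in> X"
  shows "degr U v = 5 \<and> 3 dvd b v"
proof (rule ccontr)
  assume not: "\<not> ?thesis"
  obtain M N where U: "U = M + image_mset (\<lambda>x. {v, x}) N" and vN: "v \<notin># N" and vM: "\<forall>e \<in># M. v \<notin> e"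
    and sN: "size N = degr U v" and meets: "\<forall>e \<in># M. e \<inter> (X - {v}) \<noteq> {}"
    and two: "\<forall>a c N'. N = add_mset a (add_mset c N') \<longrightarrow> a \<in> X \<or> c \<in> X"
    by (rule obtain_star[OF v])
  let ?Y = "X - {v}"
  \<comment> \<open>Splitting off \<open>r\<close> pairs leaves \<open>3 - r\<close> edges at
    \<open>v\<close> to orient, so removing \<open>v\<close> costs three edges in all.\<close>
  define r where "r = degr U v - 3"
  have deg: "degr U v = 3 + r" "r \<le> 3" using degr_ge_4[OF v] degrees[OF v] by (auto simp: r_def)
  have sub: "inside M R \<le> inside U R" for R by (simp add: U)
  have sparse_M: "inside M R + 3 \<le> 3 * card R" if "R \<subseteq> ?Y" "R \<noteq> {}" for R
  proof -
    have "R \<subseteq> X" using that(1) by blast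
    from sparse[OF this that(2)] show ?thesis using sub[of R] by simp
  qed
  have sparse_N: "inside M R + 3 + hits N R \<le> 3 * card R + 3" if "R \<subseteq> ?Y" "R \<noteq> {}" for R
  proof -
    have "inside M R \<le> inside M (insert v R)" unfolding inside_def by (rule size_filter_mset_mono) auto
    moreover have "hits N R \<le> hits N (insert v R)" by (rule hits_mono) auto
    moreover have "inside U (insert v R) = inside M (insert v R) + hits N (insert v R)"
      by (simp add: U inside_image_pair)
    moreover have "card (insert v R) = Suc (card R)"
      using that(1) finite_X by (metis Diff_subset card_insert_disjoint finite_subset insertCI subset_Diff_insert)
    moreover have "insert v R \<subseteq> X" using that(1) v by blast
    ultimately show ?thesis using sparse[of "insert v R"] by auto
  qed
  have fY: "finite ?Y" using finite_X by simp
  have sNr: "size N = 3 + r" using sN deg by simp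
  obtain L N' where N: "N = image_mset fst L + image_mset snd L + N'" and sL: "size L = r"
    and sparse_L: "\<forall>R. R \<subseteq> ?Y \<longrightarrow> R \<noteq> {} \<longrightarrow> inside (M + image_mset ends L) R + 3 \<le> 3 * card R"
    using split_off_keeping_sparse[OF fY sparse_M sparse_N sNr deg(2)] by blast
  have sN': "size N' + r = 3" using N sNr sL by simp
  \<comment> \<open>Degree 4 leaves two edges, enough for any boundary; degree 5 leaves one, enough
    for a nonzero boundary; degree 6 leaves none, and its boundary is 0.\<close>
  have "2 \<le> size N' \<or> size N' = 1 \<and> \<not> 3 dvd b v \<or> N' = {#} \<and> 3 dvd b v"
  proof -
    consider "r = 1" | "r = 2" | "r = 3" using degr_ge_4[OF v] deg by fastforce
    then show ?thesis
    proof cases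
      case 2
      then show ?thesis using not deg sN' by simp
    next
      case 3
      then show ?thesis using degrees[OF v] deg sN' by simp
    qed (use sN' in simp)
  qed
  then obtain P Q where PQ: "N' = P + Q" "3 dvd b v - (int (size P) - int (size Q))"
    by (rule split_with_residue)
  have ab: "fst p \<in> X \<or> snd p \<in> X" if p: "p \<in># L" for p
  proof -
    obtain L' where "L = add_mset p L'" using p by (metis mset_add)
    then have "N = add_mset (fst p) (add_mset (snd p) (image_mset fst L' + image_mset snd L' + N'))"
      by (simp add: N)
    then show ?thesis using two by blast
  qed
  have inN: "fst p \<in># N" "snd p \<in># N" if "p \<in># L" for p using that by (auto simp: N)
  \<comment> \<open>A pair with equal members would become a loop inside a singleton, which sparsity
    forbids.\<close>
  have L_ne: "fst p \<noteq> snd p" if p: "p \<in># L" for p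
  proof
    assume eq: "fst p = snd p"
    then have Y: "{fst p} \<subseteq> ?Y" using ab[OF p] inN[OF p] vN by auto
    obtain L' where "L = add_mset p L'" using p by (metis mset_add)
    then have "1 \<le> inside (image_mset ends L) {fst p}" using eq by (simp add: inside_def ends_def)
    moreover have "inside (M + image_mset ends L) {fst p} + 3 \<le> 3 * card {fst p}"
      using sparse_L Y by blast
    ultimately show False by simp
  qed
  let ?W = "M + image_mset ends L"
  let ?c = "\<lambda>x. b x + int (count P x) - int (count Q x)"
  have U': "U = M + image_mset (\<lambda>x. {v, x}) (image_mset fst L + image_mset snd L + P + Q)"
    unfolding U N PQ(1) by (simp add: ac_simps)
  have nori: "\<not> orientable ?Y ?W ?c"
  proof
    assume o: "orientable ?Y ?W ?c"
    have "orientable X U b"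
    proof (rule orientable_lift[where v = v and L = L and P = P and Q = Q, OF U' vM _ _ PQ(2) o])
      show "v \<notin># image_mset fst L + image_mset snd L + P + Q" using vN by (simp add: N PQ(1))
      show "\<forall>p \<in># L. fst p \<noteq> snd p" using L_ne by blast
    qed
    then show False using crit by (simp add: critical_def)
  qed
  \<comment> \<open>A split edge replaces an edge at \<open>x\<close>, so only the oriented edges to
    \<open>N'\<close> lower the degree of \<open>x\<close>; without them its boundary is unchanged
    too.\<close>
  have deg_W: "degr U x = degr ?W x + count N' x" if "x \<noteq> v" for x
    using that degr_image_ends[of L x] L_ne unfolding U by (simp add: degr_image_pair N)
  have adm': "admissible ?Y ?W ?c"
    unfolding admissible_def
  proof (intro conjI ballI)
    show "finite ?Y" by (rule fY)
  next
    fix e assume "e \<in># ?W"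
    then consider "e \<in># M" | p where "p \<in># L" "e = ends p" by auto
    then have "card e = 2 \<and> e \<inter> ?Y \<noteq> {}"
    proof cases
      case 1
      then show ?thesis using meets 1 card_edge[of e] U by simp
    next
      case 2
      have "fst p \<noteq> v" "snd p \<noteq> v" using inN[OF 2(1)] vN by auto
      then show ?thesis using L_ne[OF 2(1)] ab[OF 2(1)] 2(2) by (auto simp: ends_def)
    qed
    then show "card e = 2" "e \<inter> ?Y \<noteq> {}" by simp_all
  next
    fix x assume x: "x \<in> ?Y"
    then have "x \<in> X" "x \<noteq> v" by auto
    show "degr ?W x \<le> 5 \<or> degr ?W x = 6 \<and> 3 dvd ?c x"
    proof (cases "degr ?W x \<le> 5")
      case False
      then have "degr ?W x = 6" "3 dvd b x" "count N' x = 0"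
        using degrees[OF \<open>x \<in> X\<close>] deg_W[OF \<open>x \<noteq> v\<close>] by auto
      then show ?thesis using PQ(1) by simp
    qed simp
  qed (rule sparse_L)
  have "size ?W + 2 \<le> 3 * card ?Y"
  proof (rule smaller[OF _ adm' nori])
    show "card ?Y < card X" using v finite_X by (rule card_Diff1_less[rotated])
  next
    fix Z assume Z: "Z \<subset> ?Y"
    let ?T = "?Y - Z"
    let ?l = "size (avoiding (image_mset ends L) ?T)"
    have all: "size (avoiding U ?T) = size (avoiding M ?T) + size (filter_mset (\<lambda>x. x \<notin> ?T) N)"
      unfolding U by (simp add: avoiding_image_pair)
    have l: "2 * ?l \<le> size (filter_mset (\<lambda>x. x \<notin> ?T) N)"
      using size_filter_ends[of L ?T] by (simp add: N)
    \<comment> \<open>A split edge avoiding \<open>?T\<close> stands for two edges at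
      \<open>v\<close> avoiding \<open>?T\<close>, which saves the unit missing in
      \<open>avoiding_bound_insert\<close>. Without such a split edge only edges of \<open>M\<close>
      count, and \<open>avoiding_bound\<close> for \<open>Z\<close> suffices.\<close>
    show "size (avoiding ?W ?T) \<le> 3 * card Z"
    proof (cases "?l = 0")
      case False
      have "size (avoiding ?W ?T) = size (avoiding M ?T) + ?l" by simp
      then show ?thesis using avoiding_bound_insert[OF v Z] all l False by linarith
    next
      case l0: True
      have "size (avoiding M ?T) \<le> 3 * card Z"
      proof (cases "Z = {}")
        case True
        then have "avoiding M ?T = {#}" using meets by (auto simp: avoiding_def filter_mset_empty_iff)
        then show ?thesis by simp
      next
        case False
        have "Z \<subset> X" using Z by blast
        have "avoiding M ?T = avoiding M (X - Z)"
          unfolding avoiding_def by (rule filter_mset_cong) (use vM Z in auto)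
        then have "size (avoiding M ?T) \<le> size (avoiding U (X - Z))" by (simp add: U)
        then show ?thesis using avoiding_bound[OF \<open>Z \<subset> X\<close> False] by simp
      qed
      then show ?thesis using l0 by simp
    qed
  qed
  moreover have "size U = size ?W + 3" using sL deg sN by (simp add: U)
  moreover have "card X = card ?Y + 1" using card.remove[OF finite_X v] by simp
  ultimately show False using dense by simp
qed

lemma root_neighbours_independent:
  assumes y: "y \<in> X" and w: "w \<in> X" and yw: "{y, w} \<in># U" "y \<noteq> w"
    and ry: "e1 \<in># U" "e1 \<inter> X = {y}" and rw: "e2 \<in># U" "e2 \<inter> X = {w}"
  shows False
proof -
  obtain M N where U: "U = M + image_mset (\<lambda>x. {y, x}) N" and yN: "y \<notin># N" and yM: "\<forall>e \<in># M. y \<notin> e"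
    and sN: "size N = degr U y" and meets: "\<forall>e \<in># M. e \<inter> (X - {y}) \<noteq> {}"
    by (rule obtain_star[OF y])
  have "{y, w} \<notin># M" using yM by blast
  then have wN: "w \<in># N" using yw unfolding U by (auto simp: doubleton_eq_iff)
  have "y \<in> e1" using ry(2) by blast
  then obtain u where u: "e1 = {y, u}" "u \<noteq> y"
    using card_edge[OF ry(1)] unfolding card_2_iff by (metis doubleton_eq_iff insertE singletonD)
  then have uX: "u \<notin> X" using ry(2) by auto
  have "e1 \<notin># M" using yM u(1) by auto
  then have uN: "u \<in># N" using ry(1) u unfolding U by (auto simp: doubleton_eq_iff)
  have uw: "u \<noteq> w" using uX w by blast
  obtain N1 where N1: "N = add_mset u N1" using uN by (metis mset_add)
  then have "w \<in># N1" using wN uw by auto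
  then obtain P where P: "N = add_mset u (add_mset w P)" using N1 by (metis mset_add)
  \<comment> \<open>Three arcs leaving \<open>y\<close> contribute 3, which matches boundary 0
    modulo 3.\<close>
  have sP: "size P = 3" using P sN degr_eq_5[OF y] by simp
  let ?L = "{#(u, w)#}"
  let ?c = "\<lambda>x. b x + int (count P x) - int (count {#} x)"
  let ?Y = "X - {y}" and ?X = "X - {y} - {w}"
  let ?W = "touching M ?X"
  have nori1: "\<not> orientable ?Y (M + image_mset ends ?L) ?c"
  proof
    assume o: "orientable ?Y (M + image_mset ends ?L) ?c"
    have "orientable X U b"
    proof (rule orientable_lift[where v = y and L = ?L and P = P and Q = "{#}", OF _ yM _ _ _ o])
      show "U = M + image_mset (\<lambda>x. {y, x}) (image_mset fst ?L + image_mset snd ?L + P + {#})"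
        by (simp add: U P)
      show "y \<notin># image_mset fst ?L + image_mset snd ?L + P + {#}" using yN P by auto
      show "\<forall>p \<in># ?L. fst p \<noteq> snd p" using uw by simp
      show "3 dvd b y - (int (size P) - int (size {#}))" using degr_eq_5[OF y] by (simp add: sP)
    qed
    then show False using crit by (simp add: critical_def)
  qed
  \<comment> \<open>\<open>e2\<close> survives the removal of \<open>y\<close> and, with the split
    edge \<open>{u, w}\<close>, gives two edges from \<open>w\<close> to the root.\<close>
  have e2M: "e2 \<in># M"
  proof -
    have "y \<notin> e2" using rw(2) y yw(2) by blast
    then show ?thesis using rw(1) unfolding U by auto
  qed
  have e2: "e2 \<inter> ?Y = {w}" using rw(2) yw(2) by blast
  have nori: "\<not> orientable ?X ?W ?c"
  proof
    assume o: "orientable ?X ?W ?c"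
    have "orientable ?Y (M + image_mset ends ?L) ?c"
    proof (rule orientable_two_root_edges)
      show "\<forall>e \<in># M + image_mset ends ?L. card e = 2 \<and> e \<inter> ?Y \<noteq> {}"
        using meets card_edge w yw(2) uw by (auto simp: U ends_def)
      show "w \<in> ?Y" using w yw(2) by blast
      have "e2 \<in># filter_mset (\<lambda>e. e \<inter> ?Y = {w}) M" using e2M e2 by simp
      then have "1 \<le> size (filter_mset (\<lambda>e. e \<inter> ?Y = {w}) M)"
        by (rule size_ge_1)
      moreover have "ends (u, w) \<inter> ?Y = {w}" using uX w yw(2) by (auto simp: ends_def)
      ultimately show "2 \<le> size (filter_mset (\<lambda>e. e \<inter> ?Y = {w}) (M + image_mset ends ?L))" by simp
      have "ends (u, w) \<inter> ?X = {}" using uX by (auto simp: ends_def)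
      then have "touching (M + image_mset ends ?L) ?X = ?W" by (simp add: touching_def)
      then show "orientable (?Y - {w}) (touching (M + image_mset ends ?L) (?Y - {w})) ?c" using o by simp
    qed
    then show False using nori1 by blast
  qed
  have adm': "admissible ?X ?W ?c"
    unfolding admissible_def
  proof (intro conjI ballI allI impI)
    show "finite ?X" using finite_X by simp
  next
    fix e assume e: "e \<in># ?W"
    then have "e \<in># U" by (simp add: touching_def U)
    then show "card e = 2" by (rule card_edge)
    show "e \<inter> ?X \<noteq> {}" using e by (simp add: touching_def)
  next
    fix x assume x: "x \<in> ?X"
    have "degr ?W x \<le> degr M x" unfolding touching_def by (rule degr_le_filter)
    also have "\<dots> \<le> degr U x" by (simp add: U)
    also have "\<dots> = 5" using degr_eq_5 x by blast
    finally show "degr ?W x \<le> 5 \<or> degr ?W x = 6 \<and> 3 dvd ?c x" by blast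
  next
    fix S assume S: "S \<subseteq> ?X" "S \<noteq> {}"
    have "inside ?W S \<le> inside M S" unfolding touching_def by (rule inside_le_filter)
    also have "\<dots> \<le> inside U S" by (simp add: U)
    finally have "inside ?W S \<le> inside U S" .
    moreover have "S \<subseteq> X" using S(1) by blast
    ultimately show "inside ?W S + 3 \<le> 3 * card S" using sparse[of S] S(2) by simp
  qed
  have cX: "card X = card ?X + 2"
  proof -
    have "card X = Suc (card ?Y)" using card.remove[OF finite_X y] by simp
    moreover have "card ?Y = Suc (card ?X)"
      by (rule card.remove) (use w yw(2) finite_X in auto)
    ultimately show ?thesis by simp
  qed
  have "size ?W + 2 \<le> 3 * card ?X"
  proof (rule smaller[OF _ adm' nori])
    show "card ?X < card X" using cX by simp
  next
    fix Z assume Z: "Z \<subset> ?X"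
    let ?T = "?X - Z"
    \<comment> \<open>\<open>e2\<close> avoids \<open>?T\<close> but is discarded when
      \<open>w\<close> is merged: it is the edge saved over \<open>avoiding_bound_insert\<close> for
      \<open>w\<close>.\<close>
    have "avoiding M ?T = avoiding ?W ?T + avoiding (avoiding M ?X) ?T"
      by (metis avoiding_union touching_plus_avoiding)
    moreover have "e2 \<in># avoiding (avoiding M ?X) ?T" using e2M rw(2) by (auto simp: avoiding_def)
    then have "1 \<le> size (avoiding (avoiding M ?X) ?T)"
      by (rule size_ge_1)
    ultimately have 1: "size (avoiding ?W ?T) + 1 \<le> size (avoiding M ?T)" by simp
    have "avoiding M ?T = avoiding M (X - {w} - Z)"
      unfolding avoiding_def by (rule filter_mset_cong) (use yM in auto)
    then have "size (avoiding M ?T) \<le> size (avoiding U (X - {w} - Z))" by (simp add: U)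
    also have "\<dots> \<le> 3 * card Z + 1" by (rule avoiding_bound_insert[OF w]) (use Z in blast)
    finally show "size (avoiding ?W ?T) \<le> 3 * card Z" using 1 by simp
  qed
  \<comment> \<open>Merging \<open>w\<close> discards only root edges at \<open>w\<close>. With the
    five edges at \<open>y\<close>, at most six edges are lost for two vertices.\<close>
  moreover have "size (avoiding M ?X) \<le> 1"
  proof -
    have "size (avoiding M ?X) \<le> size (filter_mset (\<lambda>e. e \<inter> X = {w}) M)"
      unfolding avoiding_def by (rule size_filter_mset_mono) (use meets yM in blast)
    also have "\<dots> \<le> size (filter_mset (\<lambda>e. e \<inter> X = {w}) U)" by (simp add: U)
    finally show ?thesis using root_edges_le_1[OF w] by simp
  qed
  moreover have "size U = size M + 5" using sN degr_eq_5[OF y] by (simp add: U)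
  ultimately show False using dense cX size_touching_avoiding[of M ?X] by simp
qed

end

section \<open>Counting the edges at the root and eliminating the counterexample\<close>

lemma sum_root_edges:
  assumes "finite X" "\<forall>e \<in># U. card e = 2 \<and> e \<inter> X \<noteq> {}"
  shows "(\<Sum>w \<in> X. size (filter_mset (\<lambda>e. e \<inter> X = {w}) U)) = size (filter_mset (\<lambda>e. \<not> e \<subseteq> X) U)"
  using assms(2)
proof (induction U)
  case (add e U)
  have "card e = 2" "e \<inter> X \<noteq> {}" using add.prems by auto
  then obtain x y where e: "e = {x, y}" "x \<noteq> y" "x \<in> X" by (auto simp: card_2_iff)
  have "(\<Sum>w \<in> X. if e \<inter> X = {w} then 1 else 0) = (if e \<subseteq> X then 0 else 1 :: nat)"
  proof (cases "y \<in> X")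
    case True
    then show ?thesis using e by (intro sum.neutral[THEN trans]) auto
  next
    case False
    then have "e \<inter> X = {x}" "\<not> e \<subseteq> X" using e by auto
    then show ?thesis using assms(1) e(3) by simp
  qed
  moreover have "(\<Sum>w \<in> X. size (filter_mset (\<lambda>e. e \<inter> X = {w}) (add_mset e U)))
      = (\<Sum>w \<in> X. size (filter_mset (\<lambda>e. e \<inter> X = {w}) U) + (if e \<inter> X = {w} then 1 else 0))"
    by (intro sum.cong) auto
  ultimately show ?case using add by (simp add: sum.distrib)
qed simp

context dense_least_critical
begin

lemma two_root_edges:
  "card X \<noteq> 0" "size (filter_mset (\<lambda>e. \<not> e \<subseteq> X) U) = 2"
proof -
  let ?root = "\<lambda>w. filter_mset (\<lambda>e. e \<inter> X = {w}) U"
  let ?F = "filter_mset (\<lambda>e. \<not> e \<subseteq> X) U"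
  \<comment> \<open>The neighbours of the root; by \<open>root_edges_le_1\<close> their number is
    the degree of the root.\<close>
  define N where "N = {w \<in> X. ?root w \<noteq> {#}}"
  have finN: "finite N" "N \<subseteq> X" using finite_X by (auto simp: N_def)
  have ne: "X \<noteq> {}"
  proof
    assume "X = {}"
    then have "orientable X U b" using card_edge orientable_empty[of U b] by simp
    then show False using crit by (simp add: critical_def)
  qed
  then show "card X \<noteq> 0" using finite_X by simp
  have D: "size ?F = card N"
  proof -
    have "size ?F = (\<Sum>w \<in> X. size (?root w))"
      using sum_root_edges[OF finite_X, of U] card_edge edge_meets by simp
    also have "\<dots> = (\<Sum>w \<in> X. if w \<in> N then 1 else 0)"
    proof (rule sum.cong)
      fix w assume w: "w \<in> X"
      show "size (?root w) = (if w \<in> N then 1 else 0)"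
      proof (cases "?root w = {#}")
        case True
        then have "w \<notin> N" unfolding N_def by blast
        then show ?thesis unfolding True by simp
      next
        case False
        then have "0 < size (?root w)" unfolding nonempty_has_size .
        then have "size (?root w) = 1" using root_edges_le_1[OF w] by linarith
        then show ?thesis using w False by (simp add: N_def)
      qed
    qed simp
    also have "\<dots> = card N" using finN finite_X by (simp add: sum.If_cases Int_absorb1)
    finally show ?thesis .
  qed
  have sU: "size U = inside U X + card N"
    unfolding D[symmetric] inside_def by (metis multiset_partition size_union)
  have hand: "(\<Sum>x \<in> S. degr U x) = 5 * card S" if "S \<subseteq> X" for S
    using degr_eq_5 that by (subst sum.cong[OF refl, of S _ "\<lambda>_. 5"]) auto
  \<comment> \<open>Handshake including the root: an edge with only one end in \<open>X\<close> has
    its other end at the root.\<close>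
  have "card (e \<inter> X) + (if \<not> e \<subseteq> X then 1 else 0) = 2" if eU: "e \<in># U" for e
  proof (cases "e \<subseteq> X")
    case True
    then show ?thesis using card_edge[OF eU] by (simp add: Int_absorb2)
  next
    case False
    obtain x y where e: "e = {x, y}" "x \<noteq> y" "x \<in> X"
      using card_edge[OF eU] edge_meets[OF eU] by (auto simp: card_2_iff)
    then have "e \<inter> X = {x}" using False by auto
    then show ?thesis using False by simp
  qed
  then have "(\<Sum>e \<in># U. card (e \<inter> X) + (if \<not> e \<subseteq> X then 1 else 0)) = (\<Sum>e \<in># U. 2)"
    by (intro arg_cong[where f = sum_mset] image_mset_cong)
  moreover have "(\<Sum>e \<in># U. if \<not> e \<subseteq> X then 1 else 0) = size ?F"
    by (induction U) auto
  ultimately have "(\<Sum>x \<in> X. degr U x) + size ?F = 2 * size U"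
    by (simp add: sum_degr[OF finite_X] sum_mset.distrib)
  then have total: "5 * card X + card N = 2 * size U" using hand[of X] D by simp
  have indep: "card (e \<inter> N) \<le> 1" if e: "e \<in># U" for e
  proof (rule ccontr)
    assume big: "\<not> ?thesis"
    obtain y w where yw: "e = {y, w}" "y \<noteq> w" using card_edge[OF e] by (auto simp: card_2_iff)
    have "\<not> e \<inter> N \<subseteq> {x}" for x
    proof
      assume "e \<inter> N \<subseteq> {x}"
      then have "card (e \<inter> N) \<le> card {x}" by (intro card_mono) simp_all
      then show False using big by simp
    qed
    from this[of y] this[of w] have "y \<in> N" "w \<in> N" using yw by auto
    then have "y \<in> X" "w \<in> X" "?root y \<noteq> {#}" "?root w \<noteq> {#}" by (auto simp: N_def)
    then obtain e1 e2 where "e1 \<in># ?root y" "e2 \<in># ?root w" by blast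
    then have "e1 \<in># U" "e1 \<inter> X = {y}" "e2 \<in># U" "e2 \<inter> X = {w}" by auto
    then show False
      using root_neighbours_independent[OF \<open>y \<in> X\<close> \<open>w \<in> X\<close> _ yw(2)] e yw(1) by blast
  qed
  \<comment> \<open>\<open>N\<close> is independent, so the other end of an edge at \<open>N\<close>
    lies in \<open>X - N\<close> or at the root.\<close>
  have cross: "card (e \<inter> N) \<le> card (e \<inter> (X - N)) + (if \<not> e \<subseteq> X then 1 else 0)" if e: "e \<in># U" for e
  proof (cases "e \<subseteq> X")
    case True
    have fe: "finite e" using card_edge[OF e] by (intro card_ge_0_finite) simp
    have "e = (e \<inter> N) \<union> (e \<inter> (X - N))" using True by blast
    moreover have "card ((e \<inter> N) \<union> (e \<inter> (X - N))) = card (e \<inter> N) + card (e \<inter> (X - N))"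
      by (rule card_Un_disjoint) (use fe in auto)
    ultimately have "card e = card (e \<inter> N) + card (e \<inter> (X - N))" by simp
    then show ?thesis using indep[OF e] card_edge[OF e] by simp
  qed (use indep[OF e] in simp)
  have "(\<Sum>e \<in># U. card (e \<inter> N))
      \<le> (\<Sum>e \<in># U. card (e \<inter> (X - N)) + (if \<not> e \<subseteq> X then 1 else 0))"
    by (rule sum_mset_mono) (rule cross)
  moreover have "(\<Sum>e \<in># U. if \<not> e \<subseteq> X then 1 else 0) = size ?F"
    by (induction U) auto
  ultimately have "(\<Sum>x \<in> N. degr U x) \<le> (\<Sum>x \<in> X - N. degr U x) + card N"
    using D finite_X finN(1) by (simp add: sum_degr sum_mset.distrib)
  then have "5 * card N \<le> 5 * card (X - N) + card N" using hand[OF finN(2)] hand[of "X - N"] by simp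
  moreover have "card X = card N + card (X - N)"
    using finN finite_X by (metis card_Diff_subset card_mono le_add_diff_inverse)
  moreover have "inside U X + 3 \<le> 3 * card X" using sparse[of X] ne by simp
  \<comment> \<open>Density and sparsity of \<open>X\<close> give \<open>2 \<le> card N\<close>;
    density and the handshake give \<open>card X \<le> card N + 2\<close>. Then
    \<open>4 * card N \<le> 10\<close>.\<close>
  ultimately have "4 * card N \<le> 5 * card (X - N)" "2 \<le> card N" "card (X - N) \<le> 2"
    using total sU dense by linarith+
  then have "card N = 2" by linarith
  then show "size ?F = 2" using D by simp
qed

lemma no_counterexample: False
proof -
  obtain r where r: "r \<in> X" using two_root_edges(1) by fastforce
  let ?F = "filter_mset (\<lambda>e. \<not> e \<subseteq> X) U" and ?I = "filter_mset (\<lambda>e. e \<subseteq> X) U"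
  have F: "\<forall>e \<in># ?F. card e = 2 \<and> e \<inter> X \<noteq> {} \<and> \<not> e \<subseteq> X" using card_edge edge_meets by auto
  \<comment> \<open>The two root edges are oriented to match the total boundary modulo 3. What is
    left on \<open>X\<close> then sums to 0, so any \<open>r\<close> in \<open>X\<close> can be the
    new root.\<close>
  have "2 \<le> size ?F" using two_root_edges(2) by simp
  then obtain A where A: "image_mset ends A = ?F" "3 dvd (\<Sum>x \<in> X. b x) - (\<Sum>x \<in> X. net A x)"
    using orient_cut_with_residue[OF finite_X F] by metis
  let ?c = "\<lambda>x. b x - net A x"
  have U: "?F + ?I = U" by (metis add.commute multiset_partition)
  have nori: "\<not> orientable (X - {r}) ?I ?c"
  proof
    assume o: "orientable (X - {r}) ?I ?c"
    have "orientable X ?I ?c"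
      by (rule orientable_drop_root[OF finite_X _ _ r o]) (use A(2) in \<open>simp_all add: sum_subtractf\<close>)
    then have "orientable X (?F + ?I) b" by (rule orientable_union[OF A(1)])
    then show False using crit unfolding U by (simp add: critical_def)
  qed
  have adm': "admissible (X - {r}) ?I ?c"
    unfolding admissible_def
  proof (intro conjI ballI allI impI)
    show "finite (X - {r})" using finite_X by simp
  next
    fix e assume e: "e \<in># ?I"
    then show "card e = 2" using card_edge by simp
    then show "e \<inter> (X - {r}) \<noteq> {}" using e by (auto simp: card_2_iff)
  next
    fix x assume "x \<in> X - {r}"
    then have "degr ?I x \<le> 5" using degr_le_filter[of "\<lambda>e. e \<subseteq> X" U x] degr_eq_5 by auto
    then show "degr ?I x \<le> 5 \<or> degr ?I x = 6 \<and> 3 dvd ?c x" ..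
  next
    fix S assume "S \<subseteq> X - {r}" "S \<noteq> {}"
    then have "inside U S + 3 \<le> 3 * card S" using sparse[of S] by blast
    then show "inside ?I S + 3 \<le> 3 * card S" using inside_le_filter[of "\<lambda>e. e \<subseteq> X" U S] by simp
  qed
  have cX: "card X = Suc (card (X - {r}))" using card.remove[OF finite_X r] by simp
  have "size ?I + 2 \<le> 3 * card (X - {r})"
  proof (rule smaller[OF _ adm' nori])
    show "card (X - {r}) < card X" using cX by simp
  next
    fix Z assume Z: "Z \<subset> X - {r}"
    \<comment> \<open>These edges lie inside \<open>insert r Z\<close>, where sparsity gives
      \<open>3 * (card Z + 1) - 3\<close>.\<close>
    have "size (avoiding ?I (X - {r} - Z)) \<le> inside U (insert r Z)"
      unfolding avoiding_def inside_def filter_filter_mset by (rule size_filter_mset_mono) blast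
    moreover have "insert r Z \<subseteq> X" using Z r by blast
    then have "inside U (insert r Z) + 3 \<le> 3 * card (insert r Z)" by (rule sparse) simp
    moreover have "card (insert r Z) \<le> Suc (card Z)" by (rule card_insert_le_m1) simp_all
    ultimately show "size (avoiding ?I (X - {r} - Z)) \<le> 3 * card Z" by linarith
  qed
  moreover have "size U = 2 + size ?I" using U two_root_edges(2) by (metis size_union)
  ultimately show False using dense cX by simp
qed

end

section \<open>Induction on the number of non-root vertices\<close>

theorem critical_size_bound:
  assumes "admissible X U b" "critical X U b"
  shows "size U + 2 \<le> 3 * card X"
  using assms
proof (induction "card X" arbitrary: X U b rule: less_induct)
  case less
  interpret least_critical X U b
  proof
    fix Y :: "'a set" and W c
    assume Y: "card Y < card X" "admissible Y W c" "\<not> orientable Y W c"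
      "\<And>Z. Z \<subset> Y \<Longrightarrow> size (avoiding W (Y - Z)) \<le> 3 * card Z"
    \<comment> \<open>The induction hypothesis speaks of critical instances;
      \<open>bound_from_critical\<close> extends it to non-orientable ones.\<close>
    show "size W + 2 \<le> 3 * card Y"
    proof (rule bound_from_critical[OF Y(2-4)])
      fix Y' W' assume Y': "Y' \<subseteq> Y" "admissible Y' W' c" "critical Y' W' c"
      have "finite Y" using Y(2) by (simp add: admissible_def)
      then have "card Y' < card X" using Y' Y(1) by (meson card_mono le_less_trans)
      then show "size W' + 2 \<le> 3 * card Y'" using Y'(2,3) by (rule less.hyps)
    qed
  qed (fact less.prems)+
  show ?case
  proof (rule ccontr)
    assume "\<not> ?thesis"
    then interpret dense_least_critical X U b by unfold_locales simp
    show False by (rule no_counterexample)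
  qed
qed

lemma nonorientable_size_bound:
  assumes "admissible X U b" "\<not> orientable X U b"
    and "\<And>W. W \<subset> X \<Longrightarrow> size (avoiding U (X - W)) \<le> 3 * card W"
  shows "size U + 2 \<le> 3 * card X"
proof (rule bound_from_critical)
  fix Y W
  assume "admissible Y W b" "critical Y W b"
  then show "size W + 2 \<le> 3 * card Y" by (rule critical_size_bound)
qed (fact assms)+

section \<open>Flow-critical graphs\<close>

lemma count_image_mset_set:
  "finite E \<Longrightarrow> count (image_mset g (mset_set E)) v = card {e \<in> E. g e = v}"
proof (induction E rule: finite_induct)
  case (insert a E)
  have "{e \<in> insert a E. g e = v} = (if g a = v then insert a {e \<in> E. g e = v} else {e \<in> E. g e = v})"
    by auto
  then show ?case using insert by auto
qed simp

lemma net_image_mset_set: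
  assumes "finite E"
  shows "net (image_mset f (mset_set E)) v
    = int (card {e \<in> E. fst (f e) = v}) - int (card {e \<in> E. snd (f e) = v})"
  using count_image_mset_set[OF assms, of "fst \<circ> f" v] count_image_mset_set[OF assms, of "snd \<circ> f" v]
  by (simp add: net_def multiset.map_comp)

text \<open>Orientations are found as multisets of vertex pairs; peeling off one edge at a time
  gives every labelled edge, parallel ones included, its own arc.\<close>

lemma label_arcs:
  assumes "finite E" "image_mset ends A = image_mset m (mset_set E)"
  shows "\<exists>f. image_mset f (mset_set E) = A \<and> (\<forall>e \<in> E. ends (f e) = m e)"
  using assms
proof (induction E arbitrary: A rule: finite_induct)
  case empty
  then show ?case by simp
next
  case (insert e E)
  then have "image_mset ends A = add_mset (m e) (image_mset m (mset_set E))" by simp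
  then obtain B a where B: "A = add_mset a B" "ends a = m e" "image_mset ends B = image_mset m (mset_set E)"
    by (blast dest: msed_map_invR)
  obtain f where f: "image_mset f (mset_set E) = B" "\<forall>x \<in> E. ends (f x) = m x"
    using insert.IH[OF B(3)] by blast
  have "image_mset (f(e := a)) (mset_set E) = image_mset f (mset_set E)"
    by (rule image_mset_cong) (use insert.hyps in auto)
  then have "image_mset (f(e := a)) (mset_set (insert e E)) = A"
    using B(1) f(1) insert.hyps by (simp del: fun_upd_apply add: fun_upd_same)
  moreover have "\<forall>x \<in> insert e E. ends ((f(e := a)) x) = m x" using B(2) f(2) by simp
  ultimately show ?case by blast
qed

context loopless_multigraph
begin

definition edge_mset :: "'v set multiset" where
  "edge_mset = image_mset (mends G) (mset_set (medges G))"

lemma size_edge_mset: "size edge_mset = card (medges G)"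
  by (simp add: edge_mset_def)

lemma edge_mset_cases: "e \<in># edge_mset \<Longrightarrow> e \<subseteq> mverts G \<and> card e = 2"
  using mends_subset card_mends finite_medges by (auto simp: edge_mset_def)

lemma degr_edge_mset: "degr edge_mset v = mdegree G v"
  using finite_medges
  by (simp add: degr_def mdegree_def edge_mset_def filter_mset_image_mset)

lemma flow_if_orientable:
  assumes "orientable (mverts G) edge_mset (\<lambda>_. 0)"
  shows "\<exists>D. nowhere_zero_3_flow G D"
proof -
  obtain A where A: "image_mset ends A = edge_mset" "\<forall>v \<in> mverts G. 3 dvd net A v - 0"
    using assms unfolding orientable_def by blast
  obtain f where f: "image_mset f (mset_set (medges G)) = A" "\<forall>e \<in> medges G. ends (f e) = mends G e"
    using label_arcs[OF finite_medges] A(1) unfolding edge_mset_def by blast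
  let ?D = "\<lparr>verts = mverts G, arcs = medges G, tail = fst \<circ> f, head = snd \<circ> f\<rparr>"
  have "orientation G ?D" using f(2) by (simp add: orientation_def ends_def)
  moreover have "[int (out_degree ?D v) - int (in_degree ?D v) = 0] (mod 3)" if "v \<in> mverts G" for v
  proof -
    have net: "net A v = int (out_degree ?D v) - int (in_degree ?D v)"
      unfolding f(1)[symmetric] net_image_mset_set[OF finite_medges]
      by (simp add: out_degree_def in_degree_def out_arcs_def in_arcs_def)
    show ?thesis using A(2) that unfolding cong_0_iff net[symmetric] by simp
  qed
  ultimately show ?thesis unfolding nowhere_zero_3_flow_def by blast
qed

text \<open>Identifying \<open>S\<close> and keeping all other vertices as singleton parts makes
  \<open>S\<close> the root. Quotient arcs are pulled back to the ends of their edges, and a vertex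
  outside \<open>S\<close> inherits the balance of its part.\<close>

lemma orientable_if_quotient_flow:
  assumes S: "S \<subseteq> mverts G" and P: "P = insert S ((\<lambda>v. {v}) ` (mverts G - S))"
    and flow: "nowhere_zero_3_flow (quotient_graph G P) D"
  shows "orientable (mverts G - S) (touching edge_mset (mverts G - S)) (\<lambda>_. 0)"
proof -
  let ?E = "{e \<in> medges G. mends G e \<inter> (mverts G - S) \<noteq> {}}"
  have E: "{e \<in> medges G. \<not> (\<exists>p \<in> P. mends G e \<subseteq> p)} = ?E"
  proof -
    have "(\<exists>p \<in> P. mends G e \<subseteq> p) \<longleftrightarrow> mends G e \<inter> (mverts G - S) = {}" if e: "e \<in> medges G" for e
    proof
      assume "\<exists>p \<in> P. mends G e \<subseteq> p"
      then obtain p where p: "p \<in> P" "mends G e \<subseteq> p" by blast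
      have "p = S"
      proof (rule ccontr)
        assume "p \<noteq> S"
        then obtain v where "p = {v}" using p(1) P by blast
        then have "card (mends G e) \<le> card {v}" using p(2) by (intro card_mono) auto
        then show False using card_mends[OF e] by simp
      qed
      then show "mends G e \<inter> (mverts G - S) = {}" using p(2) by blast
    next
      assume "mends G e \<inter> (mverts G - S) = {}"
      then have "mends G e \<subseteq> S" using mends_subset[OF e] by blast
      then show "\<exists>p \<in> P. mends G e \<subseteq> p" using P by blast
    qed
    then show ?thesis by blast
  qed
  have finE: "finite ?E" using finite_medges by simp
  have ori: "orientation (quotient_graph G P) D"
    and bal: "\<forall>p \<in> P. [int (out_degree D p) - int (in_degree D p) = 0] (mod 3)"
    using flow by (auto simp: nowhere_zero_3_flow_def quotient_graph_def)
  have "arcs D = medges (quotient_graph G P)" using ori unfolding orientation_def by blast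
  then have arcs: "arcs D = ?E" unfolding E[symmetric] by (simp add: quotient_graph_def)
  have parts: "{p \<in> P. p \<inter> mends G e \<noteq> {}} = {tail D e, head D e}" if "e \<in> ?E" for e
  proof -
    have "e \<in> medges (quotient_graph G P)" using that unfolding E[symmetric] by (simp add: quotient_graph_def)
    then have "mends (quotient_graph G P) e = {tail D e, head D e}"
      using ori unfolding orientation_def by blast
    then show ?thesis by (simp add: quotient_graph_def)
  qed
  have part: "p = q" if "p \<in> P" "q \<in> P" "x \<in> p" "x \<in> q" for p q x
    using that P by auto
  have arc: "\<exists>a. ends a = mends G e \<and> fst a \<in> tail D e \<and> snd a \<in> head D e" if e: "e \<in> ?E" for e
  proof -
    obtain u v where uv: "mends G e = {u, v}" using card_mends[of e] e by (auto simp: card_2_iff)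
    have "mends G e \<subseteq> mverts G" using mends_subset e by blast
    then have "u \<in> \<Union>P" "v \<in> \<Union>P" using uv P by auto
    then obtain p q where pq: "p \<in> P" "u \<in> p" "q \<in> P" "v \<in> q" by blast
    have "{r \<in> P. r \<inter> mends G e \<noteq> {}} = {p, q}"
    proof (intro equalityI subsetI)
      fix r assume "r \<in> {r \<in> P. r \<inter> mends G e \<noteq> {}}"
      then have "r \<in> P" "u \<in> r \<or> v \<in> r" using uv by auto
      then show "r \<in> {p, q}" using part pq by blast
    qed (use pq uv in auto)
    then have "{tail D e, head D e} = {p, q}" using parts[OF e] by simp
    then consider "tail D e = p" "head D e = q" | "tail D e = q" "head D e = p"
      by (auto simp: doubleton_eq_iff)
    then show ?thesis
    proof cases
      case 1
      then show ?thesis using pq uv by (intro exI[of _ "(u, v)"]) (simp add: ends_def)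
    next
      case 2
      then show ?thesis using pq uv by (intro exI[of _ "(v, u)"]) (auto simp: ends_def)
    qed
  qed
  have "\<forall>e \<in> ?E. \<exists>a. ends a = mends G e \<and> fst a \<in> tail D e \<and> snd a \<in> head D e"
    by (rule ballI) (rule arc)
  then obtain f where f0: "\<forall>e \<in> ?E. ends (f e) = mends G e \<and> fst (f e) \<in> tail D e \<and> snd (f e) \<in> head D e"
    by (rule bchoice[THEN exE])
  have f: "ends (f e) = mends G e" "fst (f e) \<in> tail D e" "snd (f e) \<in> head D e" if "e \<in> ?E" for e
    using bspec[OF f0 that] by simp_all
  have inP: "tail D e \<in> P" "head D e \<in> P" if "e \<in> ?E" for e using parts[OF that] by auto
  let ?A = "image_mset f (mset_set ?E)"
  have "image_mset ends ?A = image_mset (mends G) (mset_set ?E)"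
    unfolding multiset.map_comp by (rule image_mset_cong) (use f finE in auto)
  also have "\<dots> = touching edge_mset (mverts G - S)"
    using finite_medges by (simp add: touching_def edge_mset_def filter_mset_image_mset)
  finally have "image_mset ends ?A = touching edge_mset (mverts G - S)" .
  moreover have "3 dvd net ?A v - 0" if v: "v \<in> mverts G - S" for v
  proof -
    have vP: "{v} \<in> P" using v P by blast
    have tl: "fst (f e) = v \<longleftrightarrow> tail D e = {v}" if e: "e \<in> ?E" for e
      using f(2)[OF e] part[OF inP(1)[OF e] vP] by auto
    have hd: "snd (f e) = v \<longleftrightarrow> head D e = {v}" if e: "e \<in> ?E" for e
      using f(3)[OF e] part[OF inP(2)[OF e] vP] by auto
    have 1: "{e \<in> ?E. fst (f e) = v} = {e \<in> ?E. tail D e = {v}}"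
      by (intro Collect_cong conj_cong refl tl)
    have 2: "{e \<in> ?E. snd (f e) = v} = {e \<in> ?E. head D e = {v}}"
      by (intro Collect_cong conj_cong refl hd)
    have net: "net ?A v = int (out_degree D {v}) - int (in_degree D {v})"
      unfolding net_image_mset_set[OF finE] 1 2 out_degree_def in_degree_def out_arcs_def in_arcs_def arcs ..
    show ?thesis using bal vP unfolding net cong_0_iff by simp
  qed
  ultimately show ?thesis unfolding orientable_def by blast
qed

lemma orientable_if_flow_critical:
  assumes crit: "flow_critical G" and S: "S \<subseteq> mverts G" "2 \<le> card S"
  shows "orientable (mverts G - S) (touching edge_mset (mverts G - S)) (\<lambda>_. 0)"
proof -
  let ?P = "insert S ((\<lambda>v. {v}) ` (mverts G - S))"
  have "S \<noteq> {}" using S(2) by auto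
  then have "partition_on (mverts G) ?P"
    using S(1) by (auto simp: partition_on_def disjoint_def)
  moreover have "nontrivial_partition ?P" using S(2) by (auto simp: nontrivial_partition_def)
  ultimately obtain D where "nowhere_zero_3_flow (quotient_graph G ?P) D"
    using crit unfolding flow_critical_def by blast
  then show ?thesis by (rule orientable_if_quotient_flow[OF S(1) refl])
qed

text \<open>In a smallest violating \<open>S\<close>, contracting \<open>S\<close> orients the edges
  not inside it. The boundary left on \<open>S\<close> sums to 0 modulo 3, so some \<open>r\<close>
  in \<open>S\<close> can be the root of a non-orientable instance. Smaller sets are sparse, which
  makes it admissible, and the resulting bound \<open>3 * card S - 5\<close> contradicts the
  violation.\<close>

lemma inside_bound_if_flow_critical:
  assumes crit: "flow_critical G" and S: "S \<subseteq> mverts G" "S \<noteq> {}"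
    and deg: "\<And>v. v \<in> S \<Longrightarrow> mdegree G v \<le> 6"
  shows "inside edge_mset S + 3 \<le> 3 * card S"
  using finite_subset[OF S(1) finite_mverts] S deg
proof (induction S rule: finite_psubset_induct)
  case (psubset S)
  let ?V = "mverts G" and ?U = edge_mset
  have nori: "\<not> orientable ?V ?U (\<lambda>_. 0)"
    using crit flow_if_orientable by (auto simp: flow_critical_def)
  show ?case
  proof (rule ccontr)
    assume big: "\<not> inside ?U S + 3 \<le> 3 * card S"
    have "card S \<noteq> 1"
    proof
      assume "card S = 1"
      then obtain x where x: "S = {x}" by (auto simp: card_1_singleton_iff)
      have "\<not> e \<subseteq> {x}" if "e \<in># ?U" for e
        using edge_mset_cases[OF that] card_mono[of "{x}" e] by auto
      then have "filter_mset (\<lambda>e. e \<subseteq> {x}) ?U = {#}" by (simp add: filter_mset_empty_iff)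
      then show False using big x by (simp add: inside_def)
    qed
    moreover have "card S \<noteq> 0" using psubset by simp
    ultimately have "2 \<le> card S" by linarith
    then have "orientable (?V - S) (touching ?U (?V - S)) (\<lambda>_. 0)"
      by (rule orientable_if_flow_critical[OF crit psubset.prems(1)])
    then obtain A where A: "image_mset ends A = touching ?U (?V - S)" "\<forall>v \<in> ?V - S. 3 dvd net A v - 0"
      unfolding orientable_def by blast
    let ?I = "filter_mset (\<lambda>e. e \<subseteq> S) ?U" and ?c = "\<lambda>x. 0 - net A x"
    have "avoiding ?U (?V - S) = ?I"
      unfolding avoiding_def by (rule filter_mset_cong) (use edge_mset_cases psubset.prems(1) in blast)+
    then have U: "touching ?U (?V - S) + ?I = ?U" using touching_plus_avoiding[of ?U "?V - S"] by simp
    obtain r where r: "r \<in> S" using psubset.prems(2) by blast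
    have "fst a \<in> ?V \<and> snd a \<in> ?V" if "a \<in># A" for a
    proof -
      have "ends a \<in># image_mset ends A" using that by simp
      then have "ends a \<in># ?U" unfolding A(1) touching_def by simp
      then show ?thesis using edge_mset_cases by (auto simp: ends_def)
    qed
    then have "(\<Sum>v \<in> ?V. net A v) = 0" by (intro sum_net[OF finite_mverts]) blast
    then have "(\<Sum>v \<in> S. ?c v) = (\<Sum>v \<in> ?V - S. net A v)"
      using sum.subset_diff[OF psubset.prems(1) finite_mverts, of "net A"] by (simp add: sum_negf)
    moreover have "3 dvd (\<Sum>v \<in> ?V - S. net A v)" using A(2) by (intro dvd_sum) simp
    ultimately have sum: "3 dvd (\<Sum>v \<in> S. ?c v)" by simp
    have nori': "\<not> orientable (S - {r}) ?I ?c"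
    proof
      assume o: "orientable (S - {r}) ?I ?c"
      have "orientable S ?I ?c" by (rule orientable_drop_root[OF psubset.hyps(1) _ sum r o]) simp
      then obtain B where B: "image_mset ends B = ?I" "\<forall>v \<in> S. 3 dvd net B v - ?c v"
        unfolding orientable_def by blast
      have "net B v = 0" if "v \<notin> S" for v
        by (rule net_eq_0) (use that in \<open>auto simp: B(1)\<close>)
      then have "3 dvd net B v - ?c v" if "v \<in> ?V" for v
        using B(2) A(2) that by (cases "v \<in> S") auto
      then have "orientable ?V ?I ?c" using B(1) unfolding orientable_def by blast
      then have "orientable ?V (touching ?U (?V - S) + ?I) (\<lambda>_. 0)" by (rule orientable_union[OF A(1)])
      then show False using nori U by simp
    qed
    have adm: "admissible (S - {r}) ?I ?c"
      unfolding admissible_def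
    proof (intro conjI ballI allI impI)
      show "finite (S - {r})" using psubset.hyps by simp
    next
      fix e assume e: "e \<in># ?I"
      then show "card e = 2" using edge_mset_cases by simp
      then show "e \<inter> (S - {r}) \<noteq> {}" using e by (auto simp: card_2_iff)
    next
      fix x assume x: "x \<in> S - {r}"
      have split: "degr ?U x = degr (touching ?U (?V - S)) x + degr ?I x"
        using U by (metis degr_union)
      have "degr ?U x \<le> 6" using psubset.prems(3) x by (simp add: degr_edge_mset)
      show "degr ?I x \<le> 5 \<or> degr ?I x = 6 \<and> 3 dvd ?c x"
      proof (cases "degr ?I x \<le> 5")
        case False
        then have 6: "degr ?I x = 6" "degr (touching ?U (?V - S)) x = 0"
          using split \<open>degr ?U x \<le> 6\<close> by auto
        have "net A x = 0" using degr_eq_0[OF 6(2)] by (intro net_eq_0) (simp add: A(1))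
        then show ?thesis using 6 by simp
      qed simp
    next
      fix R assume R: "R \<subseteq> S - {r}" "R \<noteq> {}"
      then have "R \<subset> S" "R \<subseteq> ?V" using r psubset.prems(1) by auto
      then have "inside ?U R + 3 \<le> 3 * card R" using psubset.IH[of R] R(2) psubset.prems(3) by blast
      then show "inside ?I R + 3 \<le> 3 * card R"
        using inside_le_filter[of "\<lambda>e. e \<subseteq> S" ?U R] by simp
    qed
    have "size ?I + 2 \<le> 3 * card (S - {r})"
    proof (rule nonorientable_size_bound[OF adm nori'])
      fix Z assume Z: "Z \<subset> S - {r}"
      \<comment> \<open>These edges lie inside \<open>insert r Z\<close>, a proper subset of
        \<open>S\<close> and hence sparse.\<close>
      have "size (avoiding ?I (S - {r} - Z)) \<le> inside ?U (insert r Z)"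
        unfolding avoiding_def inside_def filter_filter_mset by (rule size_filter_mset_mono) blast
      moreover have "insert r Z \<subset> S" "insert r Z \<subseteq> ?V" using Z r psubset.prems(1) by auto
      then have "inside ?U (insert r Z) + 3 \<le> 3 * card (insert r Z)"
        using psubset.IH[of "insert r Z"] psubset.prems(3) by blast
      moreover have "card (insert r Z) \<le> Suc (card Z)" by (rule card_insert_le_m1) simp_all
      ultimately show "size (avoiding ?I (S - {r} - Z)) \<le> 3 * card Z" by linarith
    qed
    moreover have "card S = Suc (card (S - {r}))" using card.remove[OF psubset.hyps(1) r] by simp
    ultimately show False using big by (simp add: inside_def)
  qed
qed

end

theorem mainTheorem1:
  fixes G :: "('v, 'e) multigraph"
  assumes "loopless_multigraph G"
    and "flow_critical G"
    and "card {v \<in> mverts G. 7 \<le> mdegree G v} \<le> 1"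
  shows "int (card (medges G)) \<le> 3 * int (card (mverts G)) - 5"
proof -
  interpret loopless_multigraph G by fact
  let ?V = "mverts G" and ?U = edge_mset
  have nori: "\<not> orientable ?V ?U (\<lambda>_. 0)"
    using assms(2) flow_if_orientable by (auto simp: flow_critical_def)
  have "?V \<noteq> {}"
  proof
    assume "?V = {}"
    then show False using nori orientable_empty[of ?U "\<lambda>_. 0"] edge_mset_cases by simp
  qed
  \<comment> \<open>The root is the vertex of degree at least 7 if there is one, and arbitrary
    otherwise.\<close>
  have "\<exists>z \<in> ?V. \<forall>v \<in> ?V. v \<noteq> z \<longrightarrow> mdegree G v \<le> 6"
  proof (cases "{v \<in> ?V. 7 \<le> mdegree G v} = {}")
    case True
    then show ?thesis using \<open>?V \<noteq> {}\<close> by (metis (no_types, lifting) Collect_empty_eq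
      ex_in_conv not_less_eq_eq eval_nat_numeral(3) numeral_eq_Suc)
  next
    case False
    then obtain z where z: "z \<in> ?V" "7 \<le> mdegree G z" by blast
    have "v = z" if "v \<in> ?V" "7 \<le> mdegree G v" for v
      using assms(3) z that finite_mverts
      by (metis (mono_tags, lifting) One_nat_def card_le_Suc0_iff_eq finite_subset mem_Collect_eq subsetI)
    then show ?thesis using z(1) by force
  qed
  then obtain z where z: "z \<in> ?V" "\<And>v. v \<in> ?V \<Longrightarrow> v \<noteq> z \<Longrightarrow> mdegree G v \<le> 6" by blast
  have adm: "admissible (?V - {z}) ?U (\<lambda>_. 0)"
    unfolding admissible_def
  proof (intro conjI ballI allI impI)
    show "finite (?V - {z})" using finite_mverts by simp
  next
    fix e assume e: "e \<in># ?U"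
    show "card e = 2" using edge_mset_cases[OF e] by blast
    then show "e \<inter> (?V - {z}) \<noteq> {}" using edge_mset_cases[OF e] by (auto simp: card_2_iff)
  next
    fix x assume "x \<in> ?V - {z}"
    then have "degr ?U x \<le> 6" using z(2) by (simp add: degr_edge_mset)
    then show "degr ?U x \<le> 5 \<or> degr ?U x = 6 \<and> 3 dvd (0 :: int)" by auto
  next
    fix S assume S: "S \<subseteq> ?V - {z}" "S \<noteq> {}"
    then have "S \<subseteq> ?V" "\<And>v. v \<in> S \<Longrightarrow> mdegree G v \<le> 6" using z(2) by auto
    then show "inside ?U S + 3 \<le> 3 * card S"
      using inside_bound_if_flow_critical[OF assms(2) _ S(2)] by blast
  qed
  have crit: "critical (?V - {z}) ?U (\<lambda>_. 0)"
    unfolding critical_def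
  proof (intro conjI allI impI notI)
    assume o: "orientable (?V - {z}) ?U (\<lambda>_. 0)"
    have "orientable ?V ?U (\<lambda>_. 0)"
      by (rule orientable_drop_root[OF finite_mverts _ _ z(1) o]) (use edge_mset_cases in auto)
    then show False using nori by blast
  next
    fix Y assume Y: "Y \<subset> ?V - {z}"
    then obtain y where y: "y \<in> ?V - Y" "y \<noteq> z" by blast
    \<comment> \<open>The complement of \<open>Y\<close> contains \<open>z\<close> and a second
      vertex, so identifying it is a non-trivial partition.\<close>
    have "card {y, z} \<le> card (?V - Y)" using y z(1) Y finite_mverts by (intro card_mono) auto
    then have "2 \<le> card (?V - Y)" using y(2) by simp
    moreover have "?V - (?V - Y) = Y" using Y by blast
    ultimately show "orientable Y (touching ?U Y) (\<lambda>_. 0)"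
      using orientable_if_flow_critical[OF assms(2) Diff_subset, of Y] by simp
  qed
  \<comment> \<open>The root is not counted here: \<open>3 * (card ?V - 1) - 2\<close> is the
    claimed \<open>3 * card ?V - 5\<close>.\<close>
  have "size ?U + 2 \<le> 3 * card (?V - {z})" by (rule critical_size_bound[OF adm crit])
  moreover have "card ?V = Suc (card (?V - {z}))" using card.remove[OF finite_mverts z(1)] by simp
  ultimately show ?thesis by (simp add: size_edge_mset)
qed

end
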